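(* Consider the fully discrete schemes described in the context, in which velocity integrals over species $i$ are replaced by the quadrature $\langle g\rangle_i=\sum_{\mathbf q}\omega_{\mathbf q}\,g_{\mathbf q}(\Delta v_i)^3$. Let $h(z)=z\log z-z$, $h(0)=0$. Then: (1) (Positivity, first order.) The first-order splitting scheme with the first-order, respectively second-order, flux is positivity preserving, i.e. $f_{i,k\mathbf q}^\ell\ge0$ for all $i,k,\mathbf q$ implies $f_{i,k\mathbf q}^{\ell+1}\ge0$ for all $i,k,\mathbf q$, provided $\Delta t\le\alpha\,\Delta x/\max|v^1|$ with $\alpha=1$, respectively $\alpha=\frac23$. (2) (Positivity, second order.) In the space homogeneous case the second-order IMEX scheme is positivity preserving provided $\Delta t\le\frac1{(1-2\gamma)(\nu_{ii}^{(1)}+\nu_{ij}^{(1)})}$ for $i,j\in\{1,2\}$, $i\ne j$, at all velocity nodes. (3) (Entropy, relaxation.) The relaxation step of the first-order splitting scheme satisfies $$\langle h(f_1^{\ell'})\rangle_1+\langle h(f_2^{\ell'})\rangle_2\le\langle h(f_1^{\ell})\rangle_1+\langle h(f_2^{\ell})\rangle_2 .$$ (4) (Equality case.) The inequality in (3) is an equality if and only if $f_1^\ell=A_{12}^\ell$ and $f_2^\ell=A_{21}^\ell$. In such cases $f_1^{\ell'}=A_{12}^{\ell'}$ and $f_2^{\ell'}=A_{21}^{\ell'}$. (5) (Entropy, transport.) The transport step of the first-order splitting scheme with the first-order flux satisfies, for periodic or zero boundary conditions and $\Delta t\le\Delta x/\max|v^1|$, $$\sum_{k=0}^K\big(\langle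 h(f_{1,k}^{\ell+1})\rangle_1+\langle h(f_{2,k}^{\ell+1})\rangle_2\big)\Delta x\le\sum_{k=0}^K\big(\langle h(f_{1,k}^{\ell'})\rangle_1+\langle h(f_{2,k}^{\ell'})\rangle_2\big)\Delta x .$$ (6) (Conservation.) For periodic or zero boundary conditions, either time discretization combined with either flux satisfies for all $\ell\ge0$ $$\sum_{k=0}^K\big(\langle f_{1,k}^\ell\,\mathbf a_1\rangle_1+\langle f_{2,k}^\ell\,\mathbf a_2\rangle_2\big)\Delta x=\sum_{k=0}^K\big(\langle f_{1,k}^0\,\mathbf a_1\rangle_1+\langle f_{2,k}^0\,\mathbf a_2\rangle_2\big)\Delta x,\qquad \mathbf a_{i}=m_i(1,\mathbf v,|\mathbf v|^2)^\top.$$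
   Context: Species $i\in\{1,2\}$, with $j$ the other index; masses $m_i>0$; $\Delta t,\Delta x>0$; cells $k\in\{0,\dots,K\}$. In (3)–(5) the distribution functions to which the step is applied are nonnegative, and neither species' distribution is identically zero. Velocity grid and quadrature: for each species a finite uniform Cartesian grid of nodes $\mathbf v_{\mathbf q}=(v^1_{q_1},v^2_{q_2},v^3_{q_3})$ in a cube of $\mathbb R^3$ with spacing $\Delta v_i$ in each direction (grids may differ between species); $f_{i,k\mathbf q}^\ell$ is the value in cell $k$ at node $\mathbf q$ of the grid of species $i$. Trapezoidal weights $\omega_{\mathbf q}=\omega_{q_1}\omega_{q_2}\omega_{q_3}$ with $\omega_{q_p}=1$ if $q_p$ is strictly between its minimal and maximal values and $\frac12$ otherwise. All functions of $\mathbf v$ are evaluated at the nodes; $\max|v^1|$ is over all nodes. Let $\mathbf a_i=m_i(1,\mathbf v,|\mathbf v|^2)^\top$, $\mathbf a_{12}=m_1(1,0,\mathbf v,|\mathbf v|^2)^\top$, $\mathbf a_{21}=m_2(0,1,\mathbf v,|\mathbf v|^2)^\top$, $\Lambda=\mathbb R\times\mathbb R^3\times\mathbb R^-$, $\Lambda_{12}=\mathbb R\times\mathbb R\times\mathbb R^3\times\mathbb R^-$. Implicit stage (in each cell): given grid functions $G_1,G_2$, $\tau>0$ and collision frequencies $\nu_{ij}\ge0$ (functions of the velocity node; $\nu_{ii},\nu_{ij}$ live on the grid of species $i$), set $c_i=\frac1{1+\tau(\nu_{ii}+\nu_{ij})}$; $\boldsymbol\lambda_i$ is the unique minimizer over $\boldsymbol\alpha\in\Lambda$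 of $\langle c_i\nu_{ii}e^{\boldsymbol\alpha\cdot\mathbf a_i}\rangle_i-\boldsymbol\alpha\cdot\langle c_i\nu_{ii}G_i\mathbf a_i\rangle_i$, and $\boldsymbol\lambda$ is the unique minimizer over $\boldsymbol\alpha\in\Lambda_{12}$ of $\langle c_1\nu_{12}e^{\boldsymbol\alpha\cdot\mathbf a_{12}}\rangle_1+\langle c_2\nu_{21}e^{\boldsymbol\alpha\cdot\mathbf a_{21}}\rangle_2-\boldsymbol\alpha\cdot(\langle c_1\nu_{12}G_1\mathbf a_{12}\rangle_1+\langle c_2\nu_{21}G_2\mathbf a_{21}\rangle_2)$; put $A_{ii}=e^{\boldsymbol\lambda_i\cdot\mathbf a_i}$, $A_{12}=e^{\boldsymbol\lambda\cdot\mathbf a_{12}}$, $A_{21}=e^{\boldsymbol\lambda\cdot\mathbf a_{21}}$. The stage returns $\psi_i=c_iG_i+c_i\tau(\nu_{ii}A_{ii}+\nu_{ij}A_{ij})$, equivalently $\psi_i=G_i+\tau\mathcal R_i$ with $\mathcal R_i=\nu_{ii}(A_{ii}-\psi_i)+\nu_{ij}(A_{ij}-\psi_i)$. (The paper asserts existence and uniqueness of the minimizers of the corresponding problems with continuous velocity integrals, citing earlier theory, and uses the same minimization on the velocity grid.) Target functions of $(f_1^\ell,f_2^\ell)$ in (4): $A_{12}^\ell=e^{\boldsymbol\eta\cdot\mathbf a_{12}}$, $A_{21}^\ell=e^{\boldsymbol\eta\cdot\mathbf a_{21}}$ with $\boldsymbol\eta$ the unique minimizer over $\boldsymbol\alpha\in\Lambda_{12}$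 of $\langle\nu_{12}^\ell e^{\boldsymbol\alpha\cdot\mathbf a_{12}}\rangle_1+\langle\nu_{21}^\ell e^{\boldsymbol\alpha\cdot\mathbf a_{21}}\rangle_2-\boldsymbol\alpha\cdot(\langle\nu_{12}^\ell f_1^\ell\mathbf a_{12}\rangle_1+\langle\nu_{21}^\ell f_2^\ell\mathbf a_{21}\rangle_2)$. $A_{ij}^{\ell'}$ denotes the $A_{ij}$ of the implicit stage that produces $f^{\ell'}$. Discrete transport: $\mathcal T_k(g)=\frac1{\Delta x}(\mathscr F_{k+\frac12}(g)-\mathscr F_{k-\frac12}(g))$, $\mathscr F_{k+\frac12}(g)=\frac{v^1}2(g_{k+1}+g_k)-\frac{|v^1|}2(g_{k+1}-g_k-\phi_{k+\frac12}(g))$, with $\phi_{k+\frac12}=0$ (first-order flux) or $\phi_{k+\frac12}(g)=\operatorname{minmod}(g_k-g_{k-1},g_{k+1}-g_k,g_{k+2}-g_{k+1})$ (second-order flux); $\operatorname{minmod}(a,b,c)=s\min(|a|,|b|,|c|)$ if $a,b,c$ have the same sign $s$ and $0$ otherwise. Nonnegativity of cell values is understood to include all boundary (ghost-cell) values entering the formulas. Periodic boundary conditions: periodic extension, so $\mathscr F_{K+\frac12}=\mathscr F_{-\frac12}$. Zero boundary conditions: $\mathscr F_{K+\frac12}=\mathscr F_{-\frac12}=0$ at all velocity nodes, in every evaluation of the transport operator. First-order splitting: relaxation step: $f_i^{\ell'}$ is the result of the implicit stage with $G_i=f_i^\ell$, $\tau=\Delta t$, frequencies $\nu_{ij}^\ell\ge0$;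 transport step: $f_{i,k}^{\ell+1}=f_{i,k}^{\ell'}-\Delta t\,\mathcal T_k(f_i^{\ell'})$. Second-order IMEX scheme: $\gamma=1-\frac{\sqrt2}2$, $\delta=1-\frac1{2\gamma}$, $\tau=\gamma\Delta t$; $G_i^{(1)}=f_i^\ell-\gamma\Delta t\,\mathcal T(f_i^\ell)$; $f_i^{(1)},\mathcal R_i^{(1)}$ from the implicit stage with data $G^{(1)}$ and frequencies $\nu_{ij}^{(1)}\ge0$; $G_i^{(2)}=f_i^\ell-\delta\Delta t\,\mathcal T(f_i^\ell)-(1-\delta)\Delta t\,\mathcal T(f_i^{(1)})+(1-\gamma)\Delta t\,\mathcal R_i^{(1)}$; $f_i^{(2)}$ from the implicit stage with data $G^{(2)}$ and frequencies $\nu_{ij}^{(2)}\ge0$; $f_i^{\ell+1}=f_i^{(2)}$. In the space homogeneous case $\mathcal T=0$.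
   Formalization: In (4), "equality implies f_1=A_12, f_2=A_21" assumes ν_12, ν_21 > 0 at all nodes (false for ν ≥ 0); in (5), zero boundary conditions mean that the flux formula itself vanishes at both boundaries for f' (false if the boundary fluxes are merely overwritten by 0). *)

theory Defs
  imports "HOL-Analysis.Analysis"
begin

datatype species = Sp1 | Sp2

fun other :: "species \<Rightarrow> species" where
  "other Sp1 = Sp2"
| "other Sp2 = Sp1"

text \<open>
  The node of species \<open>i\<close> with multi-index \<open>q\<close>, where \<open>q $ p \<le> qmax i $ p\<close> in each direction \<open>p\<close>,
  is \<open>vmin i + dv i * q\<close>. The spatial cells are \<open>0, \<dots>, ncell\<close>; \<open>ncell\<close> is the number \<open>K\<close> of the
  formulas.
\<close>

record bgk =
  mass :: "species \<Rightarrow> real"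
  vmin :: "species \<Rightarrow> real ^ 3"
  qmax :: "species \<Rightarrow> nat ^ 3"
  dv :: "species \<Rightarrow> real"
  dt :: real
  dx :: real
  ncell :: nat

definition valid_params :: "bgk \<Rightarrow> bool" where
  "valid_params P \<longleftrightarrow> (\<forall>i. mass P i > 0 \<and> dv P i > 0) \<and> dt P > 0 \<and> dx P > 0"

text \<open>
  A grid function is a total function on multi-indices; only its values on \<^term>\<open>nodes P i\<close> matter.
  A field carries a cell index in \<^typ>\<open>int\<close>, so that ghost cells \<open>-2, -1, K+1, K+2\<close> are available.
  In \<open>freq\<close>, \<open>\<nu> i j\<close> is the frequency $\nu_{ij}$, living on the grid of species \<open>i\<close>.
\<close>

type_synonym gridfun = "nat ^ 3 \<Rightarrow> real"
type_synonym field = "species \<Rightarrow> int \<Rightarrow> gridfun"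
type_synonym freq = "species \<Rightarrow> species \<Rightarrow> int \<Rightarrow> gridfun"
type_synonym par = "real \<times> (real ^ 3) \<times> real"
type_synonym mixpar = "real \<times> real \<times> (real ^ 3) \<times> real"

definition nodes :: "bgk \<Rightarrow> species \<Rightarrow> (nat ^ 3) set" where
  "nodes P i = {q. \<forall>p. q $ p \<le> qmax P i $ p}"

definition vel :: "bgk \<Rightarrow> species \<Rightarrow> nat ^ 3 \<Rightarrow> real ^ 3" where
  "vel P i q = (\<chi> p. vmin P i $ p + real (q $ p) * dv P i)"

definition weight :: "bgk \<Rightarrow> species \<Rightarrow> nat ^ 3 \<Rightarrow> real" where
  "weight P i q = (\<Prod>p\<in>UNIV. if 0 < q $ p \<and> q $ p < qmax P i $ p then 1 else 1/2)"

definition quad :: "bgk \<Rightarrow> species \<Rightarrow> (nat ^ 3 \<Rightarrow> 'a::real_vector) \<Rightarrow> 'a" where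
  "quad P i g = (\<Sum>q\<in>nodes P i. (weight P i q * dv P i ^ 3) *\<^sub>R g q)"

definition max_speed :: "bgk \<Rightarrow> real" where
  "max_speed P = Max (\<Union>i. (\<lambda>q. \<bar>vel P i q $ 1\<bar>) ` nodes P i)"

definition cells :: "bgk \<Rightarrow> int set" where
  "cells P = {0..int (ncell P)}"

definition nonneg_freq :: "bgk \<Rightarrow> freq \<Rightarrow> bool" where
  "nonneg_freq P \<nu> \<longleftrightarrow> (\<forall>i j. \<forall>k\<in>cells P. \<forall>q\<in>nodes P i. 0 \<le> \<nu> i j k q)"

definition nonneg_on :: "bgk \<Rightarrow> int set \<Rightarrow> field \<Rightarrow> bool" where
  "nonneg_on P C f \<longleftrightarrow> (\<forall>i. \<forall>k\<in>C. \<forall>q\<in>nodes P i. 0 \<le> f i k q)"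

definition ent :: "real \<Rightarrow> real" where
  "ent z = (if z = 0 then 0 else z * ln z - z)"

definition entropy :: "bgk \<Rightarrow> field \<Rightarrow> int \<Rightarrow> real" where
  "entropy P f k = quad P Sp1 (\<lambda>q. ent (f Sp1 k q)) + quad P Sp2 (\<lambda>q. ent (f Sp2 k q))"


section \<open>Target functions and the implicit stage\<close>

definition inv_self :: "bgk \<Rightarrow> species \<Rightarrow> nat ^ 3 \<Rightarrow> par" where
  "inv_self P i q = mass P i *\<^sub>R (1, vel P i q, (norm (vel P i q))\<^sup>2)"

text \<open>\<open>inv_mix P Sp1\<close> is $\mathbf a_{12}$ and \<open>inv_mix P Sp2\<close> is $\mathbf a_{21}$.\<close>

fun inv_mix :: "bgk \<Rightarrow> species \<Rightarrow> nat ^ 3 \<Rightarrow> mixpar" where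
  "inv_mix P Sp1 q = mass P Sp1 *\<^sub>R (1, 0, vel P Sp1 q, (norm (vel P Sp1 q))\<^sup>2)"
| "inv_mix P Sp2 q = mass P Sp2 *\<^sub>R (0, 1, vel P Sp2 q, (norm (vel P Sp2 q))\<^sup>2)"

definition exp_self :: "bgk \<Rightarrow> species \<Rightarrow> par \<Rightarrow> gridfun" where
  "exp_self P i \<alpha> q = exp (\<alpha> \<bullet> inv_self P i q)"

definition exp_mix :: "bgk \<Rightarrow> species \<Rightarrow> mixpar \<Rightarrow> gridfun" where
  "exp_mix P i \<alpha> q = exp (\<alpha> \<bullet> inv_mix P i q)"

text \<open>\<open>\<real>\<^sup>-\<close> is the open half line: the exponentials have to be integrable over velocity space.\<close>

definition Lam :: "par set" where
  "Lam = UNIV \<times> UNIV \<times> {..<0}"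

definition Lam_mix :: "mixpar set" where
  "Lam_mix = UNIV \<times> UNIV \<times> UNIV \<times> {..<0}"

definition unique_minimizer :: "('a \<Rightarrow> real) \<Rightarrow> 'a set \<Rightarrow> 'a \<Rightarrow> bool" where
  "unique_minimizer F S x \<longleftrightarrow>
     is_arg_min F (\<lambda>y. y \<in> S) x \<and> (\<forall>y. is_arg_min F (\<lambda>y. y \<in> S) y \<longrightarrow> y = x)"

definition dual_self :: "bgk \<Rightarrow> species \<Rightarrow> gridfun \<Rightarrow> gridfun \<Rightarrow> par \<Rightarrow> real" where
  "dual_self P i w g \<alpha> =
     quad P i (\<lambda>q. w q * exp_self P i \<alpha> q) - \<alpha> \<bullet> quad P i (\<lambda>q. (w q * g q) *\<^sub>R inv_self P i q)"

definition dual_mix ::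
  "bgk \<Rightarrow> (species \<Rightarrow> gridfun) \<Rightarrow> (species \<Rightarrow> gridfun) \<Rightarrow> mixpar \<Rightarrow> real" where
  "dual_mix P w g \<alpha> =
     quad P Sp1 (\<lambda>q. w Sp1 q * exp_mix P Sp1 \<alpha> q) + quad P Sp2 (\<lambda>q. w Sp2 q * exp_mix P Sp2 \<alpha> q)
     - \<alpha> \<bullet> (quad P Sp1 (\<lambda>q. (w Sp1 q * g Sp1 q) *\<^sub>R inv_mix P Sp1 q)
            + quad P Sp2 (\<lambda>q. (w Sp2 q * g Sp2 q) *\<^sub>R inv_mix P Sp2 q))"

definition stage_coeff ::
  "real \<Rightarrow> (species \<Rightarrow> species \<Rightarrow> gridfun) \<Rightarrow> species \<Rightarrow> gridfun" where
  "stage_coeff \<tau> \<nu> i q = 1 / (1 + \<tau> * (\<nu> i i q + \<nu> i (other i) q))"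

text \<open>
  The implicit stage in one cell, as a relation between the data \<open>G\<close>, the minimizers \<open>ls\<close>
  ($\boldsymbol\lambda_1,\boldsymbol\lambda_2$) and \<open>lm\<close> ($\boldsymbol\lambda$), and the result \<open>\<psi>\<close>.
  On a finite velocity grid the minimizers need not exist; the relation is then empty.
\<close>

definition implicit_stage ::
  "bgk \<Rightarrow> real \<Rightarrow> (species \<Rightarrow> species \<Rightarrow> gridfun) \<Rightarrow> (species \<Rightarrow> gridfun) \<Rightarrow>
   (species \<Rightarrow> par) \<Rightarrow> mixpar \<Rightarrow> (species \<Rightarrow> gridfun) \<Rightarrow> bool" where
  "implicit_stage P \<tau> \<nu> G ls lm \<psi> \<longleftrightarrow>
     (\<forall>i. unique_minimizer (dual_self P i (\<lambda>q. stage_coeff \<tau> \<nu> i q * \<nu> i i q) (G i)) Lam (ls i)) \<and>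
     unique_minimizer (dual_mix P (\<lambda>i q. stage_coeff \<tau> \<nu> i q * \<nu> i (other i) q) G) Lam_mix lm \<and>
     (\<forall>i. \<forall>q\<in>nodes P i.
        \<psi> i q = stage_coeff \<tau> \<nu> i q * G i q
              + stage_coeff \<tau> \<nu> i q * \<tau> *
                (\<nu> i i q * exp_self P i (ls i) q + \<nu> i (other i) q * exp_mix P i lm q))"

definition relax_op ::
  "bgk \<Rightarrow> (species \<Rightarrow> species \<Rightarrow> gridfun) \<Rightarrow> (species \<Rightarrow> par) \<Rightarrow> mixpar \<Rightarrow>
   (species \<Rightarrow> gridfun) \<Rightarrow> species \<Rightarrow> gridfun" where
  "relax_op P \<nu> ls lm \<psi> i q =
     \<nu> i i q * (exp_self P i (ls i) q - \<psi> i q) + \<nu> i (other i) q * (exp_mix P i lm q - \<psi> i q)"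

definition implicit_stages ::
  "bgk \<Rightarrow> real \<Rightarrow> freq \<Rightarrow> field \<Rightarrow> (int \<Rightarrow> species \<Rightarrow> par) \<Rightarrow> (int \<Rightarrow> mixpar) \<Rightarrow> field \<Rightarrow> bool" where
  "implicit_stages P \<tau> \<nu> G ls lm \<psi> \<longleftrightarrow>
     (\<forall>k\<in>cells P. implicit_stage P \<tau> (\<lambda>i j. \<nu> i j k) (\<lambda>i. G i k) (ls k) (lm k) (\<lambda>i. \<psi> i k))"


section \<open>Transport\<close>

datatype flux_order = First_Order | Second_Order

text \<open>
  \<open>Ghost\<close>: arbitrary prescribed ghost-cell values. \<open>Zero_Flux\<close>: the two boundary fluxes are set to
  zero; ghost values can still enter the limiter at interior interfaces.
\<close>

datatype boundary = Ghost | Periodic | Zero_Flux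

definition minmod :: "real \<Rightarrow> real \<Rightarrow> real \<Rightarrow> real" where
  "minmod a b c =
     (if sgn a = sgn b \<and> sgn b = sgn c then sgn a * min \<bar>a\<bar> (min \<bar>b\<bar> \<bar>c\<bar>) else 0)"

fun limiter :: "flux_order \<Rightarrow> (int \<Rightarrow> real) \<Rightarrow> int \<Rightarrow> real" where
  "limiter First_Order g k = 0"
| "limiter Second_Order g k = minmod (g k - g (k - 1)) (g (k + 1) - g k) (g (k + 2) - g (k + 1))"

text \<open>\<open>num_flux ord v g k\<close> is the flux through the interface $k+\frac12$, at first velocity component \<open>v\<close>.\<close>

definition num_flux :: "flux_order \<Rightarrow> real \<Rightarrow> (int \<Rightarrow> real) \<Rightarrow> int \<Rightarrow> real" where
  "num_flux ord v g k =
     v / 2 * (g (k + 1) + g k) - \<bar>v\<bar> / 2 * (g (k + 1) - g k - limiter ord g k)"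

definition bflux :: "nat \<Rightarrow> boundary \<Rightarrow> flux_order \<Rightarrow> real \<Rightarrow> (int \<Rightarrow> real) \<Rightarrow> int \<Rightarrow> real" where
  "bflux K bc ord v g k =
     (case bc of
        Ghost \<Rightarrow> num_flux ord v g k
      | Periodic \<Rightarrow> num_flux ord v (\<lambda>l. g (l mod (int K + 1))) k
      | Zero_Flux \<Rightarrow> (if k = -1 \<or> k = int K then 0 else num_flux ord v g k))"

definition transport :: "bgk \<Rightarrow> boundary \<Rightarrow> flux_order \<Rightarrow> field \<Rightarrow> field" where
  "transport P bc ord f i k q =
     (bflux (ncell P) bc ord (vel P i q $ 1) (\<lambda>l. f i l q) k
      - bflux (ncell P) bc ord (vel P i q $ 1) (\<lambda>l. f i l q) (k - 1)) / dx P"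

text \<open>Indices of the ghost cells whose values enter \<^const>\<open>transport\<close> in the cells \<open>0, \<dots>, K\<close>.\<close>

fun ghost_cells :: "nat \<Rightarrow> boundary \<Rightarrow> flux_order \<Rightarrow> int set" where
  "ghost_cells K Ghost First_Order = {-1, int K + 1}"
| "ghost_cells K Ghost Second_Order = {-2, -1, int K + 1, int K + 2}"
| "ghost_cells K Periodic ord = {}"
| "ghost_cells K Zero_Flux First_Order = {}"
| "ghost_cells K Zero_Flux Second_Order = {-1, int K + 1}"

text \<open>
  The fluxes given by the flux formula itself vanish at both boundary interfaces at all velocity
  nodes, so that setting them to zero does not alter the scheme. Without this, blocking the outflow
  piles mass up in the boundary cells and can increase the entropy: for \<open>K = 1\<close> and \<open>f = 1\<close> the two
  cell values become \<open>1 \<mp> \<theta>\<close>, \<open>1 \<plusminus> \<theta>\<close> with \<open>\<theta> = \<Delta>t \<bar>v\<^sup>1\<bar> / \<Delta>x\<close>.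
\<close>

definition zero_boundary_flux :: "bgk \<Rightarrow> flux_order \<Rightarrow> field \<Rightarrow> bool" where
  "zero_boundary_flux P ord f \<longleftrightarrow>
     (\<forall>i. \<forall>q\<in>nodes P i. num_flux ord (vel P i q $ 1) (\<lambda>l. f i l q) (-1) = 0
                      \<and> num_flux ord (vel P i q $ 1) (\<lambda>l. f i l q) (int (ncell P)) = 0)"

text \<open>
  $\Delta t\le\alpha\Delta x/\max|v^1|$, multiplied out so that there is no restriction if
  $\max|v^1|=0$.
\<close>

definition cfl :: "bgk \<Rightarrow> real \<Rightarrow> bool" where
  "cfl P \<alpha> \<longleftrightarrow> dt P * max_speed P \<le> \<alpha> * dx P"

fun cfl_const :: "flux_order \<Rightarrow> real" where
  "cfl_const First_Order = 1"
| "cfl_const Second_Order = 2/3"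


section \<open>Time discretizations\<close>

definition relaxation_step ::
  "bgk \<Rightarrow> freq \<Rightarrow> field \<Rightarrow> (int \<Rightarrow> species \<Rightarrow> par) \<Rightarrow> (int \<Rightarrow> mixpar) \<Rightarrow> field \<Rightarrow> bool" where
  "relaxation_step P \<nu> f ls lm f' \<longleftrightarrow> implicit_stages P (dt P) \<nu> f ls lm f'"

definition transport_step :: "bgk \<Rightarrow> boundary \<Rightarrow> flux_order \<Rightarrow> field \<Rightarrow> field \<Rightarrow> bool" where
  "transport_step P bc ord f' f'' \<longleftrightarrow>
     (\<forall>i. \<forall>k\<in>cells P. \<forall>q\<in>nodes P i. f'' i k q = f' i k q - dt P * transport P bc ord f' i k q)"

definition splitting_step :: "bgk \<Rightarrow> boundary \<Rightarrow> flux_order \<Rightarrow> freq \<Rightarrow> field \<Rightarrow> field \<Rightarrow> bool" where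
  "splitting_step P bc ord \<nu> f f'' \<longleftrightarrow>
     (\<exists>ls lm f'. relaxation_step P \<nu> f ls lm f' \<and> transport_step P bc ord f' f'')"

definition imex_gamma :: real where
  "imex_gamma = 1 - sqrt 2 / 2"

definition imex_delta :: real where
  "imex_delta = 1 - 1 / (2 * imex_gamma)"

text \<open>\<open>T\<close> is the discrete transport operator; it is the zero operator in the space homogeneous case.\<close>

definition imex_step :: "bgk \<Rightarrow> (field \<Rightarrow> field) \<Rightarrow> freq \<Rightarrow> freq \<Rightarrow> field \<Rightarrow> field \<Rightarrow> bool" where
  "imex_step P T \<nu>1 \<nu>2 f f'' \<longleftrightarrow>
     (\<exists>G1 ls1 lm1 f1 G2 ls2 lm2.
        (\<forall>i. \<forall>k\<in>cells P. \<forall>q\<in>nodes P i.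
           G1 i k q = f i k q - imex_gamma * dt P * T f i k q) \<and>
        implicit_stages P (imex_gamma * dt P) \<nu>1 G1 ls1 lm1 f1 \<and>
        (\<forall>i. \<forall>k\<in>cells P. \<forall>q\<in>nodes P i.
           G2 i k q = f i k q - imex_delta * dt P * T f i k q
                    - (1 - imex_delta) * dt P * T f1 i k q
                    + (1 - imex_gamma) * dt P *
                      relax_op P (\<lambda>i j. \<nu>1 i j k) (ls1 k) (lm1 k) (\<lambda>i. f1 i k) i q) \<and>
        implicit_stages P (imex_gamma * dt P) \<nu>2 G2 ls2 lm2 f'')"

text \<open>
  $\Delta t\le 1/((1-2\gamma)(\nu_{ii}+\nu_{ij}))$, multiplied out so that there is no restriction
  where the frequencies vanish; note $1-2\gamma=\sqrt2-1>0$.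
\<close>

definition imex_dt_bound :: "bgk \<Rightarrow> freq \<Rightarrow> bool" where
  "imex_dt_bound P \<nu> \<longleftrightarrow>
     (\<forall>i. \<forall>k\<in>cells P. \<forall>q\<in>nodes P i.
        dt P * ((1 - 2 * imex_gamma) * (\<nu> i i k q + \<nu> i (other i) k q)) \<le> 1)"

definition total_moments :: "bgk \<Rightarrow> field \<Rightarrow> par" where
  "total_moments P f =
     (\<Sum>k\<in>cells P. dx P *\<^sub>R (quad P Sp1 (\<lambda>q. f Sp1 k q *\<^sub>R inv_self P Sp1 q)
                          + quad P Sp2 (\<lambda>q. f Sp2 k q *\<^sub>R inv_self P Sp2 q)))"

end

theory Submission
  imports Defs
begin

text \<open>
  The minimizers lie in open sets, so the gradients of the dual functionals vanish there: the
  relaxation towards each target conserves the moments spanned by the exponents. Logarithms of the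
  targets are such moments; since the implicit stage is a convex combination of its data and the
  targets, convexity of \<open>h\<close> bounds the entropy change by minus a nonnegative combination of
  Bregman divergences, whose vanishing gives the equality case. The transport step is, for the
  upwind flux, a convex combination of neighbouring values; the limited flux loses at most
  \<open>3/2 * \<bar>v\<bar> * g k\<close> from cell \<open>k\<close>. The transport terms telescope.
\<close>

section \<open>The dual functional\<close>

text \<open>Existence of minimizers is never proved: the implicit stage is a relation that already
  supplies them, and only stationarity and uniqueness are exploited. Both dual problems have one
  shape, so they are treated as a single functional over an index set \<open>S\<close> with weights
  \<open>u\<close>, data \<open>g\<close> and exponents \<open>a\<close>. The delicate point is the
  equality case. There \<open>\<eta>\<close> belongs to the weights \<nu>, whereas the target of the
  stage belongs to the damped weights c \<nu>, and for general data the two minimizers have no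
  reason to agree. They do agree once the data are themselves of exponential form: the tangent
  inequality for \<open>exp\<close> then holds term by term, so the same parameter minimizes the
  functional for every nonnegative weight, and uniqueness identifies the two.\<close>

definition exp_dual ::
  "'s set \<Rightarrow> ('s \<Rightarrow> real) \<Rightarrow> ('s \<Rightarrow> real) \<Rightarrow> ('s \<Rightarrow> 'a::real_inner) \<Rightarrow> 'a \<Rightarrow> real" where
  "exp_dual S u g a \<alpha> = (\<Sum>s\<in>S. u s * exp (\<alpha> \<bullet> a s)) - \<alpha> \<bullet> (\<Sum>s\<in>S. (u s * g s) *\<^sub>R a s)"

text \<open>The claimed sum is the gradient \<open>d\<close> of the functional at \<open>x\<close>.
  Restricted to the line through \<open>x\<close> in direction \<open>d\<close>, the functional has
  derivative \<open>d \<bullet> d\<close> at 0, and openness of \<open>C\<close> makes 0 a local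
  minimum. One-variable calculus therefore suffices.\<close>

lemma exp_dual_stationary:
  fixes a :: "'s \<Rightarrow> 'a::real_inner"
  assumes "open C" and min: "is_arg_min (exp_dual S u g a) (\<lambda>y. y \<in> C) x"
  shows "(\<Sum>s\<in>S. (u s * (exp (x \<bullet> a s) - g s)) *\<^sub>R a s) = 0" (is "?d = 0")
proof -
  have le: "exp_dual S u g a x \<le> exp_dual S u g a y" if "y \<in> C" for y
    using min that by (auto simp: is_arg_min_def not_less)
  have "x \<in> C" using min by (simp add: is_arg_min_def)
  then obtain e where e: "e > 0" "ball x e \<subseteq> C"
    using \<open>open C\<close> open_contains_ball by blast
  define \<phi> where "\<phi> t = exp_dual S u g a (x + t *\<^sub>R ?d)" for t :: real
  have \<phi>: "\<phi> = (\<lambda>t. (\<Sum>s\<in>S. u s * exp (x \<bullet> a s + t * (?d \<bullet> a s)))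
      - (x \<bullet> (\<Sum>s\<in>S. (u s * g s) *\<^sub>R a s) + t * (?d \<bullet> (\<Sum>s\<in>S. (u s * g s) *\<^sub>R a s))))"
    by (simp add: \<phi>_def exp_dual_def inner_add_left fun_eq_iff)
  have "(\<phi> has_real_derivative
      (\<Sum>s\<in>S. u s * (exp (x \<bullet> a s) * (?d \<bullet> a s))) - ?d \<bullet> (\<Sum>s\<in>S. (u s * g s) *\<^sub>R a s)) (at 0)"
    unfolding \<phi> by (auto intro!: derivative_eq_intros sum.cong)
  also have "(\<Sum>s\<in>S. u s * (exp (x \<bullet> a s) * (?d \<bullet> a s))) - ?d \<bullet> (\<Sum>s\<in>S. (u s * g s) *\<^sub>R a s)
      = ?d \<bullet> ?d"
  proof -
    have "e \<bullet> (\<Sum>s\<in>S. (u s * (exp (x \<bullet> a s) - g s)) *\<^sub>R a s)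
        = (\<Sum>s\<in>S. u s * (exp (x \<bullet> a s) * (e \<bullet> a s))) - e \<bullet> (\<Sum>s\<in>S. (u s * g s) *\<^sub>R a s)" for e
      by (simp add: inner_sum_right sum_subtractf[symmetric] algebra_simps)
    then show ?thesis by simp
  qed
  finally have D: "DERIV \<phi> 0 :> ?d \<bullet> ?d" .
  have "?d \<bullet> ?d = 0"
  proof (rule DERIV_local_min[OF D])
    \<comment> \<open>Adding 1 keeps the denominator positive when the gradient is zero.\<close>
    show "0 < e / (norm ?d + 1)" using e(1) by (simp add: add_nonneg_pos)
    show "\<forall>t. \<bar>0 - t\<bar> < e / (norm ?d + 1) \<longrightarrow> \<phi> 0 \<le> \<phi> t"
    proof (intro allI impI)
      fix t :: real
      assume "\<bar>0 - t\<bar> < e / (norm ?d + 1)"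
      then have "\<bar>t\<bar> * (norm ?d + 1) < e"
        by (simp add: pos_less_divide_eq add_nonneg_pos)
      then have "\<bar>t\<bar> * norm ?d < e"
        using abs_ge_zero[of t] by (simp only: distrib_left mult_1_right)
      then have "x + t *\<^sub>R ?d \<in> C"
        using e(2) by (auto simp: dist_norm subset_iff)
      then show "\<phi> 0 \<le> \<phi> t" using le by (simp add: \<phi>_def)
    qed
  qed
  then show ?thesis by simp
qed

text \<open>Each summand is minimal at \<open>x\<close> by itself, so the weights enter only through
  their sign.\<close>

lemma exp_dual_argmin:
  assumes "\<And>s. s \<in> S \<Longrightarrow> u s \<ge> 0" "\<And>s. s \<in> S \<Longrightarrow> g s = exp (x \<bullet> a s)" "x \<in> C"
  shows "is_arg_min (exp_dual S u g a) (\<lambda>y. y \<in> C) x"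
proof -
  have "exp_dual S u g a x \<le> exp_dual S u g a y" for y
  proof -
    have *: "exp_dual S u g a z = (\<Sum>s\<in>S. u s * (exp (z \<bullet> a s) - (z \<bullet> a s) * exp (x \<bullet> a s)))" for z
      unfolding exp_dual_def inner_sum_right sum_subtractf[symmetric]
      by (rule sum.cong) (auto simp: assms(2) algebra_simps)
    \<comment> \<open>The graph of \<open>exp\<close> lies above its tangent at
      \<open>b\<close>.\<close>
    have "exp b - b * exp b \<le> exp c - c * exp b" for b c :: real
    proof -
      have "exp b * (1 + (c - b)) \<le> exp b * exp (c - b)"
        by (intro mult_left_mono exp_ge_add_one_self) auto
      also have "\<dots> = exp c" by (simp flip: exp_add)
      finally show ?thesis by (simp add: algebra_simps)
    qed
    then show ?thesis unfolding * using assms(1) by (intro sum_mono mult_left_mono) auto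
  qed
  then show ?thesis using assms(3) by (auto simp: is_arg_min_def not_less)
qed

section \<open>Quadrature\<close>

lemma UNIV_species: "(UNIV :: species set) = {Sp1, Sp2}"
  using species.exhaust by auto

instance species :: finite
  by standard (simp add: UNIV_species)

lemma sum_species: "(\<Sum>i\<in>UNIV. F i) = F Sp1 + F Sp2"
  by (simp add: UNIV_species)

lemma finite_nodes [simp]: "finite (nodes P i)"
proof -
  have "vec_nth ` nodes P i \<subseteq> PiE UNIV (\<lambda>p. {..qmax P i $ p})"
    by (auto simp: nodes_def)
  then have "finite (vec_nth ` nodes P i)"
    by (rule finite_subset) (auto intro!: finite_PiE)
  then show ?thesis
    by (rule finite_imageD) (auto simp: inj_on_def vec_eq_iff)
qed

definition qweight :: "bgk \<Rightarrow> species \<Rightarrow> nat ^ 3 \<Rightarrow> real" where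
  "qweight P i q = weight P i q * dv P i ^ 3"

lemma quad_eq_sum: "quad P i g = (\<Sum>q\<in>nodes P i. qweight P i q *\<^sub>R g q)"
  by (simp add: quad_def qweight_def)

lemma qweight_pos: "valid_params P \<Longrightarrow> qweight P i q > 0"
  by (auto simp: qweight_def weight_def valid_params_def intro!: mult_pos_pos prod_pos)

lemma qweight_nonneg: "valid_params P \<Longrightarrow> qweight P i q \<ge> 0"
  using qweight_pos less_imp_le by blast

lemma quad_cong: "(\<And>q. q \<in> nodes P i \<Longrightarrow> g q = g' q) \<Longrightarrow> quad P i g = quad P i g'"
  by (simp add: quad_def)

lemma quad_mono:
  fixes g g' :: gridfun
  assumes "valid_params P" "\<And>q. q \<in> nodes P i \<Longrightarrow> g q \<le> g' q"
  shows "quad P i g \<le> quad P i g'"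
  unfolding quad_eq_sum using assms(2) qweight_nonneg[OF assms(1)]
  by (auto intro!: sum_mono mult_left_mono)

lemma quad_nonneg:
  fixes g :: gridfun
  assumes "valid_params P" "\<And>q. q \<in> nodes P i \<Longrightarrow> 0 \<le> g q"
  shows "0 \<le> quad P i g"
  using quad_mono[OF assms(1), of i "\<lambda>_. 0" g] assms(2) by (simp add: quad_def)

text \<open>Boundary weights are halved but still positive, so every node is seen by the quadrature.
  This turns vanishing total dissipation into pointwise equalities.\<close>

lemma quad_nonneg_eq_0D:
  fixes g :: gridfun
  assumes "valid_params P" "\<And>q. q \<in> nodes P i \<Longrightarrow> 0 \<le> g q" "quad P i g = 0" "q \<in> nodes P i"
  shows "g q = 0"
proof -
  have "\<forall>q\<in>nodes P i. qweight P i q *\<^sub>R g q = 0"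
    using assms(3) qweight_nonneg[OF assms(1)] assms(2) unfolding quad_eq_sum
    by (subst (asm) sum_nonneg_eq_0_iff) auto
  then show ?thesis using assms(4) qweight_pos[OF assms(1), of i q] by auto
qed

lemma quad_add: "quad P i (\<lambda>q. g q + g' q) = quad P i g + quad P i g'"
  by (simp add: quad_def scaleR_add_right sum.distrib)

lemma quad_diff: "quad P i (\<lambda>q. g q - g' q) = quad P i g - quad P i g'"
  by (simp add: quad_def scaleR_diff_right sum_subtractf)

lemma quad_linear: "linear L \<Longrightarrow> quad P i (\<lambda>q. L (g q)) = L (quad P i g)"
  by (simp add: quad_def linear_sum linear_cmul)

lemma quad_scaleR: "quad P i (\<lambda>q. c *\<^sub>R g q) = c *\<^sub>R quad P i g"
  by (rule quad_linear) (rule linear_scaleR)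

lemma quad_cmult: "quad P i (\<lambda>q. c * g q) = c * quad P i g" for g :: gridfun
  using quad_scaleR[of P i c g] by simp

lemma quad_inner: "quad P i (\<lambda>q. x \<bullet> g q) = x \<bullet> quad P i g"
  by (simp add: quad_def inner_sum_right)

section \<open>First-order conditions for the minimizers\<close>

lemma dual_self_eq:
  "dual_self P i w g = exp_dual (nodes P i) (\<lambda>q. qweight P i q * w q) g (inv_self P i)"
  by (simp add: fun_eq_iff dual_self_def exp_dual_def quad_eq_sum exp_self_def mult.assoc)

text \<open>The index set is the disjoint union of the two grids, which makes the coupled
  two-species problem an instance of the same functional.\<close>

lemma dual_mix_eq:
  "dual_mix P w g = exp_dual (Sigma UNIV (nodes P)) (\<lambda>(i, q). qweight P i q * w i q)
     (\<lambda>(i, q). g i q) (\<lambda>(i, q). inv_mix P i q)"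
proof -
  have S: "(\<Sum>s\<in>Sigma UNIV (nodes P). h s)
      = (\<Sum>q\<in>nodes P Sp1. h (Sp1, q)) + (\<Sum>q\<in>nodes P Sp2. h (Sp2, q))"
    for h :: "_ \<Rightarrow> 'a::real_vector"
    using sum.Sigma[of UNIV "nodes P" "\<lambda>i q. h (i, q)"] by (simp add: sum_species)
  show ?thesis
    unfolding fun_eq_iff dual_mix_def exp_dual_def quad_eq_sum exp_mix_def S
    by (simp add: mult.assoc del: inv_mix.simps)
qed

lemma open_Lam: "open Lam" and open_Lam_mix: "open Lam_mix"
  by (auto simp: Lam_def Lam_mix_def intro!: open_Times)

lemma self_stationary:
  assumes "unique_minimizer (dual_self P i w g) Lam x"
  shows "quad P i (\<lambda>q. (w q * (exp_self P i x q - g q)) *\<^sub>R inv_self P i q) = 0"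
  using exp_dual_stationary[OF open_Lam, of "nodes P i" "\<lambda>q. qweight P i q * w q" g "inv_self P i" x] assms
  by (simp add: unique_minimizer_def dual_self_eq quad_eq_sum exp_self_def mult.assoc)

lemma mix_stationary:
  assumes "unique_minimizer (dual_mix P w g) Lam_mix x"
  shows "(\<Sum>i\<in>UNIV. quad P i (\<lambda>q. (w i q * (exp_mix P i x q - g i q)) *\<^sub>R inv_mix P i q)) = 0"
proof -
  have "(\<Sum>(i, q)\<in>Sigma UNIV (nodes P).
      ((qweight P i q * w i q) * (exp (x \<bullet> inv_mix P i q) - g i q)) *\<^sub>R inv_mix P i q) = 0"
    using exp_dual_stationary[OF open_Lam_mix assms[unfolded unique_minimizer_def dual_mix_eq, THEN conjunct1]]
    by (simp add: split_def)
  then show ?thesis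
    by (subst (asm) sum.Sigma[symmetric]) (auto simp: quad_eq_sum exp_mix_def mult.assoc)
qed

lemma self_minimizer_eq:
  assumes "valid_params P" "unique_minimizer (dual_self P i w g) Lam x" "y \<in> Lam"
    "\<And>q. q \<in> nodes P i \<Longrightarrow> w q \<ge> 0" "\<And>q. q \<in> nodes P i \<Longrightarrow> g q = exp_self P i y q"
  shows "x = y"
proof -
  have "is_arg_min (dual_self P i w g) (\<lambda>y. y \<in> Lam) y"
    unfolding dual_self_eq using assms qweight_nonneg[OF assms(1)]
    by (intro exp_dual_argmin) (auto simp: exp_self_def)
  then show ?thesis using assms(2) by (metis unique_minimizer_def)
qed

text \<open>The parameter \<open>y\<close> may originate from a problem with other weights; only the
  exponential form of \<open>g\<close> is compared.\<close>

lemma mix_minimizer_eq: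
  assumes "valid_params P" "unique_minimizer (dual_mix P w g) Lam_mix x" "y \<in> Lam_mix"
    "\<And>i q. q \<in> nodes P i \<Longrightarrow> w i q \<ge> 0" "\<And>i q. q \<in> nodes P i \<Longrightarrow> g i q = exp_mix P i y q"
  shows "x = y"
proof -
  have "is_arg_min (dual_mix P w g) (\<lambda>y. y \<in> Lam_mix) y"
    unfolding dual_mix_eq using assms qweight_nonneg[OF assms(1)]
    by (intro exp_dual_argmin) (auto simp: exp_mix_def)
  then show ?thesis using assms(2) by (metis unique_minimizer_def)
qed

text \<open>Adds up the two mass components. Being linear and mapping both mixed invariants to the
  single-species ones, it carries the mixed gradient equation over to total mass, momentum and
  energy.\<close>

fun mix_to_self :: "mixpar \<Rightarrow> par" where
  "mix_to_self (x, y, z, e) = (x + y, z, e)"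

lemma linear_mix_to_self: "linear mix_to_self"
  by (rule linearI) (auto simp: distrib_left)

lemma mix_to_self_inv_mix: "mix_to_self (inv_mix P i q) = inv_self P i q"
  by (cases i) (auto simp: inv_self_def)

text \<open>What one species sees of a mixed target: the other species' mass parameter is dropped. A
  mixed equilibrium is thereby also an equilibrium of each self-collision term.\<close>

fun self_part :: "species \<Rightarrow> mixpar \<Rightarrow> par" where
  "self_part Sp1 (x, y, z, e) = (x, z, e)"
| "self_part Sp2 (x, y, z, e) = (y, z, e)"

lemma exp_self_self_part: "exp_self P i (self_part i x) q = exp_mix P i x q"
  by (cases i; cases x) (auto simp: exp_self_def exp_mix_def inv_self_def)

lemma self_part_in_Lam: "x \<in> Lam_mix \<Longrightarrow> self_part i x \<in> Lam"
  by (cases i; cases x) (auto simp: Lam_def Lam_mix_def)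

section \<open>Entropy dissipation of the implicit stage\<close>

text \<open>The Bregman divergence of \<open>ent\<close>, whose derivative is \<open>ln\<close>. The
  convention \<open>ent 0 = 0\<close> gives \<open>breg 0 a = a\<close>.\<close>

definition breg :: "real \<Rightarrow> real \<Rightarrow> real" where
  "breg x a = ent x - ent a - ln a * (x - a)"

text \<open>Strict convexity, obtained from \<open>ln y < y - 1\<close> at \<open>y = a / x\<close>,
  which differs from 1; \<open>x = 0\<close> is separate.\<close>

lemma breg_pos:
  assumes "x \<ge> 0" "a > 0" "x \<noteq> a"
  shows "breg x a > 0"
proof (cases "x = 0")
  case True
  then show ?thesis using assms by (simp add: breg_def ent_def algebra_simps)
next
  case False
  with assms have x: "x > 0" by simp
  have "ln (a / x) < a / x - 1"
    using ln_le_minus_one[of "a / x"] ln_eq_minus_one[of "a / x"] assms x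
    by (auto simp: less_le)
  then have "x * ln (a / x) < x * (a / x - 1)" using x by simp
  then have "x * (ln a - ln x) < a - x" using x assms by (simp add: ln_div algebra_simps)
  then show ?thesis using x assms by (simp add: breg_def ent_def algebra_simps)
qed

lemma breg_self [simp]: "breg a a = 0"
  by (simp add: breg_def)

lemma breg_nonneg: "x \<ge> 0 \<Longrightarrow> a > 0 \<Longrightarrow> breg x a \<ge> 0"
  using breg_pos[of x a] by (cases "x = a") auto

text \<open>Jensen's inequality: in the average of the divergences from the mean \<open>m\<close>
  the linear terms cancel. The logarithm requires \<open>m > 0\<close>; for \<open>m = 0\<close>
  every product of coefficient and point vanishes.\<close>

lemma ent_convex3:
  assumes "p \<ge> 0" "q \<ge> 0" "r \<ge> 0" "p + q + r = 1" "x \<ge> 0" "y \<ge> 0" "z \<ge> 0"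
  shows "ent (p * x + q * y + r * z) \<le> p * ent x + q * ent y + r * ent z"
proof (cases "p * x + q * y + r * z = 0")
  case True
  then have "p * x = 0" "q * y = 0" "r * z = 0"
    using assms mult_nonneg_nonneg[of p x] mult_nonneg_nonneg[of q y] mult_nonneg_nonneg[of r z]
    by linarith+
  then have "p * ent x = 0" "q * ent y = 0" "r * ent z = 0" by (auto simp: ent_def)
  moreover have "ent 0 = 0" by (simp add: ent_def)
  ultimately show ?thesis unfolding True by linarith
next
  case False
  define m where "m = p * x + q * y + r * z"
  have "m > 0" using False assms
    by (simp add: m_def less_le)
  then have "0 \<le> p * breg x m + q * breg y m + r * breg z m"
    using assms breg_nonneg by simp
  also have "\<dots> = p * ent x + q * ent y + r * ent z - (p + q + r) * ent m
      - ln m * (m - (p + q + r) * m)"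
    by (simp add: breg_def m_def algebra_simps)
  finally show ?thesis using assms(4) by (simp add: m_def)
qed

lemma ent_convex2:
  assumes "0 \<le> t" "t \<le> 1" "x \<ge> 0" "y \<ge> 0"
  shows "ent ((1 - t) * x + t * y) \<le> (1 - t) * ent x + t * ent y"
  using ent_convex3[of "1 - t" t 0 x y 0] assms by simp

section \<open>The implicit stage in a single cell\<close>

lemma stage_coeff_pos:
  assumes "\<tau> > 0" "\<nu> i i q \<ge> 0" "\<nu> i (other i) q \<ge> 0"
  shows "stage_coeff \<tau> \<nu> i q > 0"
  unfolding stage_coeff_def using assms by (intro divide_pos_pos add_pos_nonneg) auto

lemma stage_coeff_sum:
  assumes "\<tau> > 0" "\<nu> i i q \<ge> 0" "\<nu> i (other i) q \<ge> 0"
  shows "stage_coeff \<tau> \<nu> i q * (1 + \<tau> * (\<nu> i i q + \<nu> i (other i) q)) = 1"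
proof -
  have "1 + \<tau> * (\<nu> i i q + \<nu> i (other i) q) > 0"
    using assms by (intro add_pos_nonneg) auto
  then show ?thesis by (simp add: stage_coeff_def)
qed

locale stage =
  fixes P :: bgk and \<tau> :: real and \<nu> :: "species \<Rightarrow> species \<Rightarrow> gridfun"
    and G :: "species \<Rightarrow> gridfun" and ls :: "species \<Rightarrow> par" and lm :: mixpar
    and \<psi> :: "species \<Rightarrow> gridfun"
  assumes valid: "valid_params P" and tau: "\<tau> > 0"
    and freq: "\<And>i j q. q \<in> nodes P i \<Longrightarrow> \<nu> i j q \<ge> 0"
    and st: "implicit_stage P \<tau> \<nu> G ls lm \<psi>"
begin

abbreviation c :: "species \<Rightarrow> gridfun" where "c \<equiv> stage_coeff \<tau> \<nu>"

lemma c_pos: "q \<in> nodes P i \<Longrightarrow> c i q > 0"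
  using tau freq by (intro stage_coeff_pos) auto

lemma c_sum: "q \<in> nodes P i \<Longrightarrow> c i q * (1 + \<tau> * (\<nu> i i q + \<nu> i (other i) q)) = 1"
  using tau freq by (intro stage_coeff_sum) auto

lemma psi_eq:
  "q \<in> nodes P i \<Longrightarrow> \<psi> i q = c i q * G i q + (c i q * \<tau> * \<nu> i i q) * exp_self P i (ls i) q
      + (c i q * \<tau> * \<nu> i (other i) q) * exp_mix P i lm q"
  using st by (auto simp: implicit_stage_def algebra_simps)

text \<open>The increment expressed through the data \<open>G\<close>, with exactly the weights of
  the dual functionals, so that the gradient equations apply to it.\<close>

lemma psi_minus_G:
  assumes "q \<in> nodes P i"
  shows "\<psi> i q - G i q = \<tau> * (c i q * \<nu> i i q * (exp_self P i (ls i) q - G i q)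
    + c i q * \<nu> i (other i) q * (exp_mix P i lm q - G i q))"
proof -
  have "G i q = c i q * (1 + \<tau> * (\<nu> i i q + \<nu> i (other i) q)) * G i q"
    using c_sum[OF assms] by simp
  then show ?thesis unfolding psi_eq[OF assms] by (simp add: algebra_simps)
qed

text \<open>The same increment expressed through the result \<open>\<psi>\<close>, the form in which
  the second IMEX stage uses it.\<close>

lemma psi_minus_G_relax_op:
  assumes "q \<in> nodes P i"
  shows "\<psi> i q - G i q = \<tau> * relax_op P \<nu> ls lm \<psi> i q"
proof -
  have "\<psi> i q * (1 + \<tau> * (\<nu> i i q + \<nu> i (other i) q))
      = (c i q * (1 + \<tau> * (\<nu> i i q + \<nu> i (other i) q))) *
        (G i q + \<tau> * \<nu> i i q * exp_self P i (ls i) q + \<tau> * \<nu> i (other i) q * exp_mix P i lm q)"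
    unfolding psi_eq[OF assms] by (simp add: algebra_simps)
  then have "\<psi> i q * (1 + \<tau> * (\<nu> i i q + \<nu> i (other i) q))
      = G i q + \<tau> * \<nu> i i q * exp_self P i (ls i) q + \<tau> * \<nu> i (other i) q * exp_mix P i lm q"
    unfolding c_sum[OF assms] by simp
  then show ?thesis unfolding relax_op_def by (simp add: algebra_simps)
qed

text \<open>Exponential targets are positive, so dropping them gives a lower bound whatever the sign
  of \<open>G\<close>.\<close>

lemma psi_ge:
  assumes "q \<in> nodes P i"
  shows "c i q * G i q \<le> \<psi> i q"
  unfolding psi_eq[OF assms] using c_pos[OF assms] freq[OF assms] tau
  by (simp add: exp_self_def exp_mix_def)

lemma psi_nonneg: "q \<in> nodes P i \<Longrightarrow> G i q \<ge> 0 \<Longrightarrow> \<psi> i q \<ge> 0"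
  using psi_ge[of q i] c_pos[of q i] mult_nonneg_nonneg[of "c i q" "G i q"] by linarith

lemma self_moments:
  "quad P i (\<lambda>q. (c i q * \<nu> i i q * (exp_self P i (ls i) q - G i q)) *\<^sub>R inv_self P i q) = 0"
  using st by (intro self_stationary) (auto simp: implicit_stage_def)

lemma mix_moments:
  "(\<Sum>i\<in>UNIV. quad P i (\<lambda>q. (c i q * \<nu> i (other i) q * (exp_mix P i lm q - G i q)) *\<^sub>R inv_mix P i q)) = 0"
  using st by (intro mix_stationary) (auto simp: implicit_stage_def)

text \<open>Self-collisions conserve the moments of each species; mixed collisions conserve them
  only in the sum over the species, after \<open>mix_to_self\<close>.\<close>

lemma moments:
  "(\<Sum>i\<in>UNIV. quad P i (\<lambda>q. (\<psi> i q - G i q) *\<^sub>R inv_self P i q)) = 0"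
proof -
  have "quad P i (\<lambda>q. (\<psi> i q - G i q) *\<^sub>R inv_self P i q)
      = \<tau> *\<^sub>R mix_to_self (quad P i (\<lambda>q. (c i q * \<nu> i (other i) q * (exp_mix P i lm q - G i q)) *\<^sub>R inv_mix P i q))"
    (is "_ = \<tau> *\<^sub>R mix_to_self (quad P i ?m)") for i
  proof -
    have "quad P i (\<lambda>q. (\<psi> i q - G i q) *\<^sub>R inv_self P i q)
      = quad P i (\<lambda>q. \<tau> *\<^sub>R ((c i q * \<nu> i i q * (exp_self P i (ls i) q - G i q)) *\<^sub>R inv_self P i q
          + mix_to_self (?m q)))"
      by (rule quad_cong)
         (simp add: psi_minus_G linear_cmul[OF linear_mix_to_self] mix_to_self_inv_mix
           scaleR_add_right scaleR_add_left distrib_left del: mix_to_self.simps inv_mix.simps)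
    then show ?thesis
      by (simp add: quad_scaleR quad_add self_moments quad_linear[OF linear_mix_to_self])
  qed
  then have "(\<Sum>i\<in>UNIV. quad P i (\<lambda>q. (\<psi> i q - G i q) *\<^sub>R inv_self P i q)) =
    \<tau> *\<^sub>R mix_to_self (\<Sum>i\<in>UNIV. quad P i (\<lambda>q. (c i q * \<nu> i (other i) q * (exp_mix P i lm q - G i q)) *\<^sub>R inv_mix P i q))"
    by (simp add: linear_sum[OF linear_mix_to_self] scaleR_sum_right)
  then show ?thesis using linear_0[OF linear_mix_to_self] by (simp add: mix_moments)
qed

text \<open>
  By Jensen's inequality the entropy increment is at most the weighted sum of
  \<open>ent A - ent G = ln A * (A - G) - breg G A\<close> over the two targets, and \<open>ln A\<close> is a combination of
  the conserved quantities.
\<close>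

lemma entropy_dissipation:
  assumes G: "\<And>i q. q \<in> nodes P i \<Longrightarrow> G i q \<ge> 0"
  shows "(\<Sum>i\<in>UNIV. quad P i (\<lambda>q. ent (\<psi> i q)))
    \<le> (\<Sum>i\<in>UNIV. quad P i (\<lambda>q. ent (G i q)))
      - (\<Sum>i\<in>UNIV. quad P i (\<lambda>q. \<tau> * (c i q * \<nu> i (other i) q * breg (G i q) (exp_mix P i lm q))))"
proof -
  let ?B = "\<lambda>i q. \<tau> * (c i q * \<nu> i (other i) q * breg (G i q) (exp_mix P i lm q))"
  let ?S = "\<lambda>i q. (c i q * \<nu> i i q * (exp_self P i (ls i) q - G i q)) *\<^sub>R inv_self P i q"
  let ?M = "\<lambda>i q. (c i q * \<nu> i (other i) q * (exp_mix P i lm q - G i q)) *\<^sub>R inv_mix P i q"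
  have "ent (\<psi> i q) \<le> ent (G i q) - ?B i q + \<tau> * (ls i \<bullet> ?S i q) + \<tau> * (lm \<bullet> ?M i q)"
    if q: "q \<in> nodes P i" for i q
  proof -
    define g A B a b where "g = G i q" and "A = exp_self P i (ls i) q" and "B = exp_mix P i lm q"
      and "a = c i q * \<tau> * \<nu> i i q" and "b = c i q * \<tau> * \<nu> i (other i) q"
    note d = this
    have AB: "A > 0" "B > 0" "ln A = ls i \<bullet> inv_self P i q" "ln B = lm \<bullet> inv_mix P i q"
      by (auto simp: d exp_self_def exp_mix_def)
    have ab: "a \<ge> 0" "b \<ge> 0" "c i q + a + b = 1" "g \<ge> 0"
      using c_pos[OF q] freq[OF q] tau c_sum[OF q] G[OF q] by (auto simp: d algebra_simps)
    have "ent (\<psi> i q) \<le> c i q * ent g + a * ent A + b * ent B"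
      unfolding psi_eq[OF q] d[symmetric] using ab AB c_pos[OF q] by (intro ent_convex3) auto
    also have "\<dots> = (c i q + a + b) * ent g - a * breg g A - b * breg g B
        + a * (ln A * (A - g)) + b * (ln B * (B - g))"
      by (simp add: breg_def algebra_simps)
    \<comment> \<open>The self-collision divergence is discarded; the mixed one is kept to detect
      equality.\<close>
    also have "\<dots> \<le> ent g - b * breg g B + a * (ln A * (A - g)) + b * (ln B * (B - g))"
      using breg_nonneg[of g A] ab AB by simp
    also have "\<dots> = ent (G i q) - ?B i q + \<tau> * (ls i \<bullet> ?S i q) + \<tau> * (lm \<bullet> ?M i q)"
      unfolding AB(3,4) unfolding d by (simp add: algebra_simps)
    finally show ?thesis .
  qed
  then have "(\<Sum>i\<in>UNIV. quad P i (\<lambda>q. ent (\<psi> i q))) \<le>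
      (\<Sum>i\<in>UNIV. quad P i (\<lambda>q. ent (G i q) - ?B i q + \<tau> * (ls i \<bullet> ?S i q) + \<tau> * (lm \<bullet> ?M i q)))"
    by (intro sum_mono quad_mono valid) auto
  also have "\<dots> = (\<Sum>i\<in>UNIV. quad P i (\<lambda>q. ent (G i q))) - (\<Sum>i\<in>UNIV. quad P i (?B i))
      + \<tau> * (\<Sum>i\<in>UNIV. ls i \<bullet> quad P i (?S i)) + \<tau> * (lm \<bullet> (\<Sum>i\<in>UNIV. quad P i (?M i)))"
    by (simp only: quad_add quad_diff quad_cmult quad_inner sum.distrib sum_subtractf
        sum_distrib_left inner_sum_right)
  also have "\<dots> = (\<Sum>i\<in>UNIV. quad P i (\<lambda>q. ent (G i q))) - (\<Sum>i\<in>UNIV. quad P i (?B i))"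
    by (simp only: self_moments mix_moments) simp
  finally show ?thesis .
qed

lemma mix_breg_nonneg:
  assumes "\<And>i q. q \<in> nodes P i \<Longrightarrow> G i q \<ge> 0" "q \<in> nodes P i"
  shows "0 \<le> \<tau> * (c i q * \<nu> i (other i) q * breg (G i q) (exp_mix P i lm q))"
  using assms c_pos[OF assms(2)] freq[OF assms(2)] tau
  by (intro mult_nonneg_nonneg breg_nonneg) (auto simp: exp_mix_def)

lemma entropy_le:
  assumes "\<And>i q. q \<in> nodes P i \<Longrightarrow> G i q \<ge> 0"
  shows "(\<Sum>i\<in>UNIV. quad P i (\<lambda>q. ent (\<psi> i q))) \<le> (\<Sum>i\<in>UNIV. quad P i (\<lambda>q. ent (G i q)))"
proof -
  have "0 \<le> (\<Sum>i\<in>UNIV. quad P i (\<lambda>q. \<tau> * (c i q * \<nu> i (other i) q * breg (G i q) (exp_mix P i lm q))))"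
    using mix_breg_nonneg[OF assms] by (intro sum_nonneg quad_nonneg valid) auto
  then show ?thesis using entropy_dissipation[OF assms] by linarith
qed

text \<open>Equality forces the nonnegative dissipation to vanish at every node. Where the cross
  frequency is positive, strict positivity of the divergence identifies the data with the
  target.\<close>

lemma entropy_eqD:
  assumes G: "\<And>i q. q \<in> nodes P i \<Longrightarrow> G i q \<ge> 0"
    and eq: "(\<Sum>i\<in>UNIV. quad P i (\<lambda>q. ent (\<psi> i q))) = (\<Sum>i\<in>UNIV. quad P i (\<lambda>q. ent (G i q)))"
    and q: "q \<in> nodes P i" and pos: "\<nu> i (other i) q > 0"
  shows "G i q = exp_mix P i lm q"
proof (rule ccontr)
  assume ne: "G i q \<noteq> exp_mix P i lm q"
  let ?B = "\<lambda>i q. \<tau> * (c i q * \<nu> i (other i) q * breg (G i q) (exp_mix P i lm q))"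
  have nn: "0 \<le> quad P i (?B i)" for i
    using mix_breg_nonneg[OF G] by (intro quad_nonneg valid) auto
  have "(\<Sum>i\<in>UNIV. quad P i (?B i)) = 0"
    using entropy_dissipation[OF G] eq nn by (intro antisym sum_nonneg) auto
  then have "quad P i (?B i) = 0"
    using nn by (subst (asm) sum_nonneg_eq_0_iff) auto
  then have "?B i q = 0"
    using mix_breg_nonneg[OF G] by (intro quad_nonneg_eq_0D[OF valid _ _ q, where g = "?B i"]) auto
  moreover have "?B i q > 0"
    using tau c_pos[OF q] pos G[OF q] ne
    by (intro mult_pos_pos breg_pos) (auto simp: exp_mix_def)
  ultimately show False by linarith
qed

lemma lm_in: "lm \<in> Lam_mix"
  using st by (auto simp: implicit_stage_def unique_minimizer_def is_arg_min_def)

text \<open>Exponential data minimize all three dual functionals, so uniqueness makes every target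
  equal to the data and the increment zero.\<close>

lemma equilibrium:
  assumes "x \<in> Lam_mix" and G: "\<And>i q. q \<in> nodes P i \<Longrightarrow> G i q = exp_mix P i x q"
  shows "lm = x" "q \<in> nodes P i \<Longrightarrow> \<psi> i q = G i q"
proof -
  show *: "lm = x"
    using st assms c_pos freq
    by (intro mix_minimizer_eq[OF valid, of "\<lambda>i q. c i q * \<nu> i (other i) q" G])
       (auto simp: implicit_stage_def less_imp_le)
  assume q: "q \<in> nodes P i"
  have "ls i = self_part i x"
    using st assms c_pos freq
    by (intro self_minimizer_eq[OF valid, of i "\<lambda>q. c i q * \<nu> i i q" "G i"])
       (auto simp: implicit_stage_def less_imp_le self_part_in_Lam exp_self_self_part)
  then show "\<psi> i q = G i q"
    using psi_minus_G[OF q] by (simp add: * G[OF q] exp_self_self_part)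
qed

end

section \<open>Discrete transport\<close>

text \<open>A minmod value lies between 0 and each of its arguments.\<close>

lemma minmod_le: "minmod a b c \<le> max 0 a" "minmod a b c \<le> max 0 b"
  and minmod_ge: "minmod a b c \<ge> min 0 b" "minmod a b c \<ge> min 0 c"
  by (auto simp: minmod_def sgn_if)

text \<open>The second-order value comes from the half slope: \<open>limiter ord g k / 2\<close> is
  at most \<open>g k / 2\<close> for nonnegative values, so the upwind reconstruction is at most
  \<open>3/2 * g k\<close>. Its reciprocal is the CFL constant.\<close>

fun limiter_const :: "flux_order \<Rightarrow> real" where
  "limiter_const First_Order = 1"
| "limiter_const Second_Order = 3/2"

lemma num_flux_upwind:
  "v \<ge> 0 \<Longrightarrow> num_flux ord v g k = v * (g k + limiter ord g k / 2)"
  "v \<le> 0 \<Longrightarrow> num_flux ord v g k = v * (g (k + 1) - limiter ord g k / 2)"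
  by (auto simp: num_flux_def field_simps)

text \<open>For \<open>v \<ge> 0\<close> the backward difference bounds the limiter; for
  \<open>v < 0\<close> the central difference keeps the reconstruction from the right nonnegative,
  so nothing leaves through this interface.\<close>

lemma num_flux_le:
  assumes "g k \<ge> 0" "g (k + 1) \<ge> 0" "ord = Second_Order \<Longrightarrow> g (k - 1) \<ge> 0"
  shows "num_flux ord v g k \<le> limiter_const ord * max 0 v * g k"
proof (cases "v \<ge> 0")
  case True
  have "g k + limiter ord g k / 2 \<le> limiter_const ord * g k"
    using assms minmod_le(1)[of "g k - g (k - 1)" "g (k + 1) - g k" "g (k + 2) - g (k + 1)"]
    by (cases ord) auto
  then have "v * (g k + limiter ord g k / 2) \<le> v * (limiter_const ord * g k)"
    using True by (intro mult_left_mono)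
  then show ?thesis using True by (simp add: num_flux_upwind mult_ac)
next
  case False
  have "g (k + 1) - limiter ord g k / 2 \<ge> 0"
    using assms minmod_le(2)[of "g k - g (k - 1)" "g (k + 1) - g k" "g (k + 2) - g (k + 1)"]
    by (cases ord) auto
  then show ?thesis using False by (simp add: num_flux_upwind mult_nonpos_nonneg)
qed

text \<open>The mirror image of \<open>num_flux_le\<close>, for outflow through the left
  interface.\<close>

lemma num_flux_ge:
  assumes "g k \<ge> 0" "g (k - 1) \<ge> 0" "ord = Second_Order \<Longrightarrow> g (k + 1) \<ge> 0"
  shows "num_flux ord v g (k - 1) \<ge> - (limiter_const ord * max 0 (- v) * g k)"
proof (cases "v \<ge> 0")
  case True
  have "g (k - 1) + limiter ord g (k - 1) / 2 \<ge> 0"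
    using assms
      minmod_ge(1)[where b = "g k - g (k - 1)" and a = "g (k - 1) - g (k - 2)" and c = "g (k + 1) - g k"]
    by (cases ord) (auto simp: algebra_simps)
  then show ?thesis using True by (simp add: num_flux_upwind)
next
  case False
  have "g k - limiter ord g (k - 1) / 2 \<le> limiter_const ord * g k"
    using assms
      minmod_ge(2)[where b = "g k - g (k - 1)" and a = "g (k - 1) - g (k - 2)" and c = "g (k + 1) - g k"]
    by (cases ord) (auto simp: algebra_simps)
  then have "v * (limiter_const ord * g k) \<le> v * (g k - limiter ord g (k - 1) / 2)"
    using False by (intro mult_left_mono_neg) auto
  then show ?thesis using False by (simp add: num_flux_upwind mult_ac)
qed

lemma bflux_bounds:
  assumes k: "k \<in> {0..int K}" and g: "\<And>l. l \<in> {0..int K} \<union> ghost_cells K bc ord \<Longrightarrow> g l \<ge> 0"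
  shows "bflux K bc ord v g k \<le> limiter_const ord * max 0 v * g k"
    and "bflux K bc ord v g (k - 1) \<ge> - (limiter_const ord * max 0 (- v) * g k)"
proof -
  have c: "limiter_const ord \<ge> 0" by (cases ord) auto
  have "bflux K bc ord v g k \<le> limiter_const ord * max 0 v * g k \<and>
    bflux K bc ord v g (k - 1) \<ge> - (limiter_const ord * max 0 (- v) * g k)"
  proof (cases bc)
    case Ghost
    have "g l \<ge> 0" if "l \<in> {-1..int K + 1}" for l
      using g[of l] that Ghost by (cases ord; cases "l = -1"; cases "l = int K + 1") auto
    then show ?thesis using k
      by (auto simp: Ghost bflux_def intro!: num_flux_le num_flux_ge)
  next
    case Periodic
    have "g (l mod (int K + 1)) \<ge> 0" for l
      using pos_mod_bound[of "int K + 1" l] by (intro g) auto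
    moreover have "k mod (int K + 1) = k" using k by simp
    ultimately show ?thesis
      using num_flux_le[of "\<lambda>l. g (l mod (int K + 1))" k ord v]
        num_flux_ge[of "\<lambda>l. g (l mod (int K + 1))" k ord v]
      using g[of k] k by (simp add: Periodic bflux_def)
  next
    case Zero_Flux
    have in_g: "g l \<ge> 0" if "l \<in> {0..int K}" for l
      using g that by auto
    have bd: "g (- 1) \<ge> 0" "g (int K + 1) \<ge> 0" if "ord = Second_Order"
      using g that Zero_Flux by auto
    \<comment> \<open>At a closed boundary interface the flux is 0, and the two bounds reduce to
      these signs.\<close>
    have gk: "limiter_const ord * max 0 v * g k \<ge> 0" "limiter_const ord * max 0 (- v) * g k \<ge> 0"
      using c in_g[OF k] by auto
    have "num_flux ord v g k \<le> limiter_const ord * max 0 v * g k" if "k \<noteq> int K"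
    proof (rule num_flux_le)
      show "g (k - 1) \<ge> 0" if "ord = Second_Order"
        using in_g[of "k - 1"] bd[OF that] k by (cases "k = 0") auto
    qed (use that k in_g in auto)
    moreover have "num_flux ord v g (k - 1) \<ge> - (limiter_const ord * max 0 (- v) * g k)" if "k \<noteq> 0"
    proof (rule num_flux_ge)
      show "g (k + 1) \<ge> 0" if "ord = Second_Order"
        using in_g[of "k + 1"] bd[OF that] k by (cases "k = int K") auto
    qed (use that k in_g in auto)
    ultimately show ?thesis using gk k by (auto simp: Zero_Flux bflux_def)
  qed
  then show "bflux K bc ord v g k \<le> limiter_const ord * max 0 v * g k"
    and "bflux K bc ord v g (k - 1) \<ge> - (limiter_const ord * max 0 (- v) * g k)" by auto
qed

section \<open>Positivity of the transport step under the CFL condition\<close>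

lemma cfl_speed:
  assumes "valid_params P" "cfl P \<alpha>" "q \<in> nodes P i"
  shows "dt P * \<bar>vel P i q $ 1\<bar> / dx P \<le> \<alpha>"
proof -
  have "\<bar>vel P i q $ 1\<bar> \<le> max_speed P"
    unfolding max_speed_def using assms(3) by (intro Max_ge) auto
  then have "dt P * \<bar>vel P i q $ 1\<bar> \<le> dt P * max_speed P"
    using assms(1) by (intro mult_left_mono) (auto simp: valid_params_def)
  also have "\<dots> \<le> \<alpha> * dx P" using assms(2) by (simp add: cfl_def)
  finally show ?thesis using assms(1) by (simp add: valid_params_def pos_divide_le_eq)
qed

lemma transport_step_nonneg:
  assumes P: "valid_params P" and cfl: "cfl P (cfl_const ord)"
    and step: "transport_step P bc ord f f'"
    and f: "nonneg_on P (cells P) f" "nonneg_on P (ghost_cells (ncell P) bc ord) f"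
  shows "nonneg_on P (cells P) f'"
  unfolding nonneg_on_def
proof (intro allI ballI)
  fix i k q assume k: "k \<in> cells P" and q: "q \<in> nodes P i"
  define v \<theta> g where "v = vel P i q $ 1" and "\<theta> = dt P / dx P" and "g = (\<lambda>l. f i l q)"
  note d = this
  have g: "g l \<ge> 0" if "l \<in> {0..int (ncell P)} \<union> ghost_cells (ncell P) bc ord" for l
    using f q that by (auto simp: nonneg_on_def g_def cells_def)
  have k': "k \<in> {0..int (ncell P)}" using k by (simp add: cells_def)
  let ?F = "bflux (ncell P) bc ord v g"
  have \<theta>: "\<theta> \<ge> 0" using P by (simp add: \<theta>_def valid_params_def less_imp_le)
  \<comment> \<open>For a given velocity only one interface can drain the cell, so the two outflow
    bounds add up to a single factor \<bar>v\<bar>.\<close>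
  have "limiter_const ord * max 0 v * g k + limiter_const ord * max 0 (- v) * g k
      = limiter_const ord * \<bar>v\<bar> * g k" by (simp add: max_def)
  then have "?F k - ?F (k - 1) \<le> limiter_const ord * \<bar>v\<bar> * g k"
    using bflux_bounds[where g = g and bc = bc and ord = ord and v = v, OF k' g] by linarith
  then have "\<theta> * (?F k - ?F (k - 1)) \<le> \<theta> * (limiter_const ord * \<bar>v\<bar> * g k)"
    using \<theta> by (rule mult_left_mono)
  also have "\<dots> = (limiter_const ord * (dt P * \<bar>v\<bar> / dx P)) * g k" by (simp add: \<theta>_def)
  also have "\<dots> \<le> 1 * g k"
  proof (rule mult_right_mono)
    have "limiter_const ord * r \<le> 1" if "r \<le> cfl_const ord" for r
      using that by (cases ord) auto
    then show "limiter_const ord * (dt P * \<bar>v\<bar> / dx P) \<le> 1"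
      using cfl_speed[OF P cfl q] by (simp only: v_def)
    show "g k \<ge> 0" using g k' by auto
  qed
  finally have "\<theta> * (?F k - ?F (k - 1)) \<le> g k" by simp
  then show "0 \<le> f' i k q"
    using step k q by (simp add: transport_step_def transport_def d)
qed

section \<open>Telescoping over the cells, boundary fluxes and transport entropy\<close>

lemma sum_shift_down:
  fixes h :: "int \<Rightarrow> 'a::ab_group_add"
  shows "(\<Sum>k\<in>{0..int K}. h (k - 1)) = (\<Sum>k\<in>{0..int K}. h k) + h (- 1) - h (int K)"
proof (induction K)
  case (Suc K)
  have "{0..int (Suc K)} = insert (int K + 1) {0..int K}" by auto
  then show ?case using Suc by (simp add: algebra_simps)
qed simp

lemma sum_shift_up:
  fixes h :: "int \<Rightarrow> 'a::ab_group_add"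
  shows "(\<Sum>k\<in>{0..int K}. h (k + 1)) = (\<Sum>k\<in>{0..int K}. h k) + h (int K + 1) - h 0"
  using sum_shift_down[of "\<lambda>k. h (k + 1)" K] by (simp add: algebra_simps)

lemma bflux_boundary:
  assumes "bc = Periodic \<or> bc = Zero_Flux"
  shows "bflux K bc ord v g (int K) = bflux K bc ord v g (- 1)"
proof (cases "bc = Zero_Flux")
  case False
  then have bc: "bc = Periodic" using assms by simp
  have "(int K + j + 1) mod (int K + 1) = j mod (int K + 1)" for j
    using mod_add_self2[of j "int K + 1"] by (simp add: algebra_simps)
  \<comment> \<open>The limited flux through interface K reads the cells K-1 to K+2, which
    periodicity identifies with -2 to 1, the stencil of interface -1.\<close>
  from this[of "-2"] this[of "-1"] this[of 0] this[of 1]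
  show ?thesis unfolding bc bflux_def num_flux_def
    by (cases ord) (simp_all add: algebra_simps)
qed (simp add: bflux_def)

lemma sum_transport:
  assumes "bc = Periodic \<or> bc = Zero_Flux"
  shows "(\<Sum>k\<in>cells P. transport P bc ord f i k q) = 0"
  by (simp add: transport_def cells_def sum_subtractf sum_shift_down bflux_boundary[OF assms]
      flip: sum_divide_distrib)

text \<open>
  The upwind step is a convex combination of two neighbouring values, and the hypotheses on the
  boundary values make the shifted sum of \<open>ent (g (k \<plusminus> 1))\<close> agree with the unshifted one.
\<close>

lemma upwind_entropy:
  assumes g: "\<And>k. k \<in> {0..int K} \<Longrightarrow> g k \<ge> 0"
    and bd: "v > 0 \<Longrightarrow> g (- 1) = g (int K)" "v < 0 \<Longrightarrow> g (int K + 1) = g 0"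
    and \<theta>: "\<theta> \<ge> 0" "\<theta> * \<bar>v\<bar> \<le> 1"
  shows "(\<Sum>k\<in>{0..int K}. ent (g k - \<theta> * (num_flux First_Order v g k - num_flux First_Order v g (k - 1))))
    \<le> (\<Sum>k\<in>{0..int K}. ent (g k))"
proof -
  define t where "t = \<theta> * \<bar>v\<bar>"
  have t: "0 \<le> t" "t \<le> 1" using \<theta> by (auto simp: t_def)
  \<comment> \<open>\<open>n\<close> is the upwind neighbour, on the left or on the right according
    to the sign of \<open>v\<close>.\<close>
  have conv: ?thesis
    if n: "\<And>k. k \<in> {0..int K} \<Longrightarrow> n k \<ge> 0"
      and F: "\<And>k. g k - \<theta> * (num_flux First_Order v g k - num_flux First_Order v g (k - 1))
        = (1 - t) * g k + t * n k"
      and s: "(\<Sum>k\<in>{0..int K}. ent (n k)) = (\<Sum>k\<in>{0..int K}. ent (g k))" for n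
  proof -
    have "(\<Sum>k\<in>{0..int K}. ent ((1 - t) * g k + t * n k))
        \<le> (\<Sum>k\<in>{0..int K}. (1 - t) * ent (g k) + t * ent (n k))"
      using g n t by (intro sum_mono ent_convex2) auto
    also have "\<dots> = (1 - t) * (\<Sum>k\<in>{0..int K}. ent (g k)) + t * (\<Sum>k\<in>{0..int K}. ent (n k))"
      by (simp add: sum.distrib flip: sum_distrib_left)
    finally show ?thesis unfolding F s by (simp add: algebra_simps)
  qed
  consider "v > 0" | "v < 0" | "v = 0" by linarith
  then show ?thesis
  proof cases
    case 1
    have "g (k - 1) \<ge> 0" if "k \<in> {0..int K}" for k
      using that bd(1)[OF 1] g[of "k - 1"] g[of "int K"] by (cases "k = 0") auto
    then show ?thesis using 1 bd(1)[OF 1] sum_shift_down[of "\<lambda>k. ent (g k)" K]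
      by (intro conv[of "\<lambda>k. g (k - 1)"]) (auto simp: num_flux_upwind t_def algebra_simps)
  next
    case 2
    have "g (k + 1) \<ge> 0" if "k \<in> {0..int K}" for k
      using that bd(2)[OF 2] g[of "k + 1"] g[of 0] by (cases "k = int K") auto
    then show ?thesis using 2 bd(2)[OF 2] sum_shift_up[of "\<lambda>k. ent (g k)" K]
      by (intro conv[of "\<lambda>k. g (k + 1)"]) (auto simp: num_flux_upwind t_def algebra_simps)
  next
    case 3
    then show ?thesis by (simp add: num_flux_def)
  qed
qed

text \<open>Both boundary conditions reduce to the plain flux formula on all integers: for a
  periodic extension, or for the given field when its boundary fluxes vanish.\<close>

lemma transport_step_entropy:
  assumes P: "valid_params P"
    and bc: "bc = Periodic \<or> bc = Zero_Flux \<and> zero_boundary_flux P First_Order f"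
    and cfl: "cfl P 1" and step: "transport_step P bc First_Order f f'"
    and f: "nonneg_on P (cells P) f" and q: "q \<in> nodes P i"
  shows "(\<Sum>k\<in>cells P. ent (f' i k q)) \<le> (\<Sum>k\<in>cells P. ent (f i k q))"
proof -
  define v \<theta> where "v = vel P i q $ 1" and "\<theta> = dt P / dx P"
  define K where "K = ncell P"
  define g where "g = (if bc = Periodic then (\<lambda>l. f i (l mod (int K + 1)) q) else (\<lambda>l. f i l q))"
  have gk: "g k = f i k q" if "k \<in> {0..int K}" for k
    using that by (auto simp: g_def)
  have flux: "bflux K bc First_Order v (\<lambda>l. f i l q) k = num_flux First_Order v g k"
    if "k \<in> {-1..int K}" for k
    using bc q by (auto simp: bflux_def g_def zero_boundary_flux_def v_def K_def)
  have bd: "v > 0 \<Longrightarrow> g (- 1) = g (int K)" "v < 0 \<Longrightarrow> g (int K + 1) = g 0"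
  proof -
    have "(- 1) mod (int K + 1) = int K mod (int K + 1)" "(int K + 1) mod (int K + 1) = 0 mod (int K + 1)"
      using mod_add_self2[of "-1" "int K + 1"] by auto
    \<comment> \<open>A vanishing upwind flux with \<open>v \<noteq> 0\<close> means a vanishing
      upwind value, so the two values to be compared are both 0.\<close>
    moreover have "num_flux First_Order v g (- 1) = 0" "num_flux First_Order v g (int K) = 0" if "bc \<noteq> Periodic"
      using bc q that by (auto simp: g_def zero_boundary_flux_def v_def K_def)
    ultimately show "v > 0 \<Longrightarrow> g (- 1) = g (int K)" "v < 0 \<Longrightarrow> g (int K + 1) = g 0"
      by (cases "bc = Periodic"; force simp: g_def num_flux_upwind)+
  qed
  have "f' i k q = g k - \<theta> * (num_flux First_Order v g k - num_flux First_Order v g (k - 1))"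
    if "k \<in> {0..int K}" for k
    using step that q flux[of k] flux[of "k - 1"]
    by (simp add: transport_step_def cells_def K_def transport_def gk[unfolded K_def] v_def \<theta>_def)
  then have "(\<Sum>k\<in>cells P. ent (f' i k q)) = (\<Sum>k\<in>{0..int K}.
      ent (g k - \<theta> * (num_flux First_Order v g k - num_flux First_Order v g (k - 1))))"
    by (simp add: cells_def K_def)
  also have "\<dots> \<le> (\<Sum>k\<in>{0..int K}. ent (g k))"
  proof (rule upwind_entropy)
    show "g k \<ge> 0" if "k \<in> {0..int K}" for k
      using f that q by (simp add: gk nonneg_on_def cells_def K_def)
    show "\<theta> \<ge> 0" using P by (simp add: \<theta>_def valid_params_def less_imp_le)
    show "\<theta> * \<bar>v\<bar> \<le> 1" using cfl_speed[OF P cfl q] by (simp add: \<theta>_def v_def)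
  qed (use bd in auto)
  also have "\<dots> = (\<Sum>k\<in>cells P. ent (f i k q))" by (simp add: gk cells_def K_def)
  finally show ?thesis .
qed

lemma entropy_eq_sum: "entropy P f k = (\<Sum>i\<in>UNIV. quad P i (\<lambda>q. ent (f i k q)))"
  by (simp add: entropy_def sum_species)

lemma sum_quad: "(\<Sum>k\<in>A. quad P i (g k)) = quad P i (\<lambda>q. \<Sum>k\<in>A. g k q)"
  unfolding quad_def by (simp add: scaleR_sum_right) (rule sum.swap)

lemma transport_step_total_entropy:
  assumes P: "valid_params P"
    and bc: "bc = Periodic \<or> bc = Zero_Flux \<and> zero_boundary_flux P First_Order f"
    and cfl: "cfl P 1" and step: "transport_step P bc First_Order f f'"
    and f: "nonneg_on P (cells P) f"
  shows "(\<Sum>k\<in>cells P. entropy P f' k * dx P) \<le> (\<Sum>k\<in>cells P. entropy P f k * dx P)"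
proof -
  have "(\<Sum>k\<in>cells P. entropy P h k) = (\<Sum>i\<in>UNIV. quad P i (\<lambda>q. \<Sum>k\<in>cells P. ent (h i k q)))" for h
    unfolding entropy_eq_sum by (subst sum.swap) (simp add: sum_quad)
  then have "(\<Sum>k\<in>cells P. entropy P f' k) \<le> (\<Sum>k\<in>cells P. entropy P f k)"
    using transport_step_entropy[OF assms]
    by (simp only:) (intro sum_mono[of UNIV] quad_mono P)
  then show ?thesis using P by (simp add: valid_params_def less_imp_le mult_right_mono flip: sum_distrib_right)
qed

section \<open>Moments\<close>

definition cell_moments :: "bgk \<Rightarrow> field \<Rightarrow> int \<Rightarrow> par" where
  "cell_moments P f k = (\<Sum>i\<in>UNIV. quad P i (\<lambda>q. f i k q *\<^sub>R inv_self P i q))"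

lemma total_moments_eq: "total_moments P f = dx P *\<^sub>R (\<Sum>k\<in>cells P. cell_moments P f k)"
  by (simp add: total_moments_def cell_moments_def sum_species scaleR_sum_right)

lemma cell_moments_cong:
  "(\<And>i q. q \<in> nodes P i \<Longrightarrow> f i k q = g i k q) \<Longrightarrow> cell_moments P f k = cell_moments P g k"
  unfolding cell_moments_def by (intro sum.cong quad_cong) auto

lemma cell_moments_add:
  "cell_moments P (\<lambda>i k q. f i k q + g i k q) k = cell_moments P f k + cell_moments P g k"
  by (simp add: cell_moments_def scaleR_add_left quad_add sum.distrib)

lemma cell_moments_scaleR:
  "cell_moments P (\<lambda>i k q. c * f i k q) k = c *\<^sub>R cell_moments P f k"
  by (simp add: cell_moments_def quad_scaleR scaleR_sum_right flip: scaleR_scaleR)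

text \<open>The invariants do not depend on the cell, so the sum over cells can be taken first and
  telescopes at each node.\<close>

lemma sum_cell_moments_transport:
  assumes "bc = Periodic \<or> bc = Zero_Flux"
  shows "(\<Sum>k\<in>cells P. cell_moments P (transport P bc ord f) k) = 0"
proof -
  have "(\<Sum>k\<in>cells P. cell_moments P (transport P bc ord f) k)
      = (\<Sum>i\<in>UNIV. quad P i (\<lambda>q. (\<Sum>k\<in>cells P. transport P bc ord f i k q) *\<^sub>R inv_self P i q))"
    unfolding cell_moments_def by (subst sum.swap) (simp add: sum_quad scaleR_sum_left)
  then show ?thesis by (simp add: sum_transport[OF assms] quad_def)
qed

section \<open>From one cell to fields: conservation for both time discretizations\<close>

lemma stageI:
  assumes "valid_params P" "\<tau> > 0" "nonneg_freq P \<nu>" "implicit_stages P \<tau> \<nu> G ls lm \<psi>" "k \<in> cells P"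
  shows "stage P \<tau> (\<lambda>i j. \<nu> i j k) (\<lambda>i. G i k) (ls k) (lm k) (\<lambda>i. \<psi> i k)"
  using assms by unfold_locales (auto simp: nonneg_freq_def implicit_stages_def)

lemma dt_pos: "valid_params P \<Longrightarrow> dt P > 0"
  by (simp add: valid_params_def)

lemma relaxation_stageI:
  assumes "valid_params P" "nonneg_freq P \<nu>" "relaxation_step P \<nu> f ls lm f'" "k \<in> cells P"
  shows "stage P (dt P) (\<lambda>i j. \<nu> i j k) (\<lambda>i. f i k) (ls k) (lm k) (\<lambda>i. f' i k)"
  using assms unfolding relaxation_step_def by (intro stageI dt_pos)

lemma stage_cell_moments:
  assumes "valid_params P" "\<tau> > 0" "nonneg_freq P \<nu>" "implicit_stages P \<tau> \<nu> G ls lm \<psi>" "k \<in> cells P"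
  shows "cell_moments P \<psi> k = cell_moments P G k"
proof -
  interpret stage P \<tau> "\<lambda>i j. \<nu> i j k" "\<lambda>i. G i k" "ls k" "lm k" "\<lambda>i. \<psi> i k"
    by (rule stageI[OF assms])
  have "cell_moments P \<psi> k - cell_moments P G k = 0"
    using moments
    by (simp add: cell_moments_def scaleR_diff_left quad_diff sum_subtractf)
  then show ?thesis by simp
qed

text \<open>The relaxation term is \<tau>^-1 times the difference of result and data, which have
  equal moments.\<close>

lemma stage_relax_op_moments:
  assumes "valid_params P" "\<tau> > 0" "nonneg_freq P \<nu>" "implicit_stages P \<tau> \<nu> G ls lm \<psi>" "k \<in> cells P"
  shows "cell_moments P (\<lambda>i k. relax_op P (\<lambda>i j. \<nu> i j k) (ls k) (lm k) (\<lambda>i. \<psi> i k) i) k = 0"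
    (is "cell_moments P ?R k = 0")
proof -
  interpret stage P \<tau> "\<lambda>i j. \<nu> i j k" "\<lambda>i. G i k" "ls k" "lm k" "\<lambda>i. \<psi> i k"
    by (rule stageI[OF assms])
  have "cell_moments P \<psi> k = cell_moments P (\<lambda>i k q. G i k q + \<tau> * ?R i k q) k"
    using psi_minus_G_relax_op by (intro cell_moments_cong) (simp add: algebra_simps)
  then have "\<tau> *\<^sub>R cell_moments P ?R k = 0"
    using stage_cell_moments[OF assms] by (simp add: cell_moments_add cell_moments_scaleR)
  then show ?thesis using tau by simp
qed

lemma splitting_step_moments:
  assumes P: "valid_params P" and bc: "bc = Periodic \<or> bc = Zero_Flux" and \<nu>: "nonneg_freq P \<nu>"
    and step: "splitting_step P bc ord \<nu> f f''"
  shows "total_moments P f'' = total_moments P f"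
proof -
  obtain ls lm f' where r: "relaxation_step P \<nu> f ls lm f'" and t: "transport_step P bc ord f' f''"
    using step by (auto simp: splitting_step_def)
  have "cell_moments P f'' k = cell_moments P f k + (- dt P) *\<^sub>R cell_moments P (transport P bc ord f') k"
    if k: "k \<in> cells P" for k
  proof -
    have "cell_moments P f'' k = cell_moments P (\<lambda>i k q. f' i k q + (- dt P) * transport P bc ord f' i k q) k"
      using t k by (intro cell_moments_cong) (simp add: transport_step_def)
    then show ?thesis
      using stage_cell_moments[OF P dt_pos[OF P] \<nu> r[unfolded relaxation_step_def] k]
      unfolding cell_moments_add cell_moments_scaleR by simp
  qed
  then show ?thesis
    by (simp add: total_moments_eq sum_subtractf sum_cell_moments_transport[OF bc]
        flip: scaleR_sum_right)
qed

lemma imex_gamma_bounds: "0 < imex_gamma" "imex_gamma < 1/2"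
proof -
  have "1 < sqrt 2" "sqrt 2 < 2" using real_sqrt_less_mono[of 2 4] by auto
  then show "0 < imex_gamma" "imex_gamma < 1/2" by (auto simp: imex_gamma_def)
qed

lemma imex_tau_pos: "valid_params P \<Longrightarrow> imex_gamma * dt P > 0"
  using imex_gamma_bounds by (simp add: valid_params_def)

text \<open>The relaxation term has zero moments in every cell, the two transport terms only after
  summation over the cells.\<close>

lemma imex_step_moments:
  assumes P: "valid_params P" and bc: "bc = Periodic \<or> bc = Zero_Flux"
    and \<nu>: "nonneg_freq P \<nu>1" "nonneg_freq P \<nu>2"
    and step: "imex_step P (transport P bc ord) \<nu>1 \<nu>2 f f''"
  shows "total_moments P f'' = total_moments P f"
proof -
  let ?T = "transport P bc ord"
  obtain G1 ls1 lm1 f1 G2 ls2 lm2 where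
    s1: "implicit_stages P (imex_gamma * dt P) \<nu>1 G1 ls1 lm1 f1" and
    G2: "\<forall>i. \<forall>k\<in>cells P. \<forall>q\<in>nodes P i.
           G2 i k q = f i k q - imex_delta * dt P * ?T f i k q
                    - (1 - imex_delta) * dt P * ?T f1 i k q
                    + (1 - imex_gamma) * dt P *
                      relax_op P (\<lambda>i j. \<nu>1 i j k) (ls1 k) (lm1 k) (\<lambda>i. f1 i k) i q" and
    s2: "implicit_stages P (imex_gamma * dt P) \<nu>2 G2 ls2 lm2 f''"
    using step by (auto simp: imex_step_def)
  let ?R = "\<lambda>i k. relax_op P (\<lambda>i j. \<nu>1 i j k) (ls1 k) (lm1 k) (\<lambda>i. f1 i k) i"
  let ?a = "- (imex_delta * dt P)" and ?b = "- ((1 - imex_delta) * dt P)"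
    and ?c = "(1 - imex_gamma) * dt P"
  have "cell_moments P f'' k = cell_moments P f k + ?a *\<^sub>R cell_moments P (?T f) k
      + ?b *\<^sub>R cell_moments P (?T f1) k" if k: "k \<in> cells P" for k
  proof -
    have "cell_moments P f'' k = cell_moments P G2 k"
      by (rule stage_cell_moments[OF P imex_tau_pos[OF P] \<nu>(2) s2 k])
    also have "\<dots> = cell_moments P (\<lambda>i k q. f i k q + ?a * ?T f i k q + ?b * ?T f1 i k q + ?c * ?R i k q) k"
      using G2 k by (intro cell_moments_cong) simp
    also have "\<dots> = cell_moments P f k + ?a *\<^sub>R cell_moments P (?T f) k
      + ?b *\<^sub>R cell_moments P (?T f1) k + ?c *\<^sub>R cell_moments P ?R k"
      unfolding cell_moments_add cell_moments_scaleR ..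
    also have "cell_moments P ?R k = 0"
      by (rule stage_relax_op_moments[OF P imex_tau_pos[OF P] \<nu>(1) s1 k])
    finally show ?thesis by simp
  qed
  then have "(\<Sum>k\<in>cells P. cell_moments P f'' k) = (\<Sum>k\<in>cells P. cell_moments P f k)
    + ?a *\<^sub>R (\<Sum>k\<in>cells P. cell_moments P (?T f) k) + ?b *\<^sub>R (\<Sum>k\<in>cells P. cell_moments P (?T f1) k)"
    unfolding scaleR_sum_right sum.distrib[symmetric] by (rule sum.cong[OF refl])
  then show ?thesis by (simp add: total_moments_eq sum_cell_moments_transport[OF bc])
qed

section \<open>Positivity and the equality case\<close>

lemma implicit_stages_nonneg:
  assumes "valid_params P" "\<tau> > 0" "nonneg_freq P \<nu>" "implicit_stages P \<tau> \<nu> G ls lm \<psi>"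
    and "nonneg_on P (cells P) G"
  shows "nonneg_on P (cells P) \<psi>"
  unfolding nonneg_on_def
proof (intro allI ballI)
  fix i k q assume k: "k \<in> cells P" and q: "q \<in> nodes P i"
  interpret stage P \<tau> "\<lambda>i j. \<nu> i j k" "\<lambda>i. G i k" "ls k" "lm k" "\<lambda>i. \<psi> i k"
    by (rule stageI[OF assms(1-4) k])
  show "0 \<le> \<psi> i k q" using psi_nonneg[OF q] assms(5) k q by (simp add: nonneg_on_def)
qed

text \<open>
  In the space homogeneous case \<open>G2 = ((1 - \<gamma>) f1 - (1 - 2 \<gamma>) f) / \<gamma>\<close>, and \<open>f1 \<ge> c f\<close>; the time
  step restriction says that \<open>(1 - \<gamma>) c \<ge> 1 - 2 \<gamma>\<close>.
\<close>

lemma imex_step_nonneg: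
  assumes P: "valid_params P" and \<nu>: "nonneg_freq P \<nu>1" "nonneg_freq P \<nu>2"
    and dt: "imex_dt_bound P \<nu>1"
    and step: "imex_step P (\<lambda>g i k q. 0) \<nu>1 \<nu>2 f f''" and f: "nonneg_on P (cells P) f"
  shows "nonneg_on P (cells P) f''"
proof -
  define \<gamma> where "\<gamma> = imex_gamma"
  have \<gamma>: "0 < \<gamma>" "\<gamma> < 1/2" using imex_gamma_bounds by (auto simp: \<gamma>_def)
  obtain G1 ls1 lm1 f1 G2 ls2 lm2 where
    G1: "\<forall>i. \<forall>k\<in>cells P. \<forall>q\<in>nodes P i. G1 i k q = f i k q" and
    s1: "implicit_stages P (\<gamma> * dt P) \<nu>1 G1 ls1 lm1 f1" and
    G2: "\<forall>i. \<forall>k\<in>cells P. \<forall>q\<in>nodes P i. G2 i k q = f i k q + (1 - \<gamma>) * dt P *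
            relax_op P (\<lambda>i j. \<nu>1 i j k) (ls1 k) (lm1 k) (\<lambda>i. f1 i k) i q" and
    s2: "implicit_stages P (\<gamma> * dt P) \<nu>2 G2 ls2 lm2 f''"
    using step unfolding imex_step_def \<gamma>_def[symmetric] mult_zero_right diff_0_right by blast
  have \<tau>: "\<gamma> * dt P > 0" using imex_tau_pos[OF P] by (simp add: \<gamma>_def)
  have "0 \<le> G2 i k q" if k: "k \<in> cells P" and q: "q \<in> nodes P i" for i k q
  proof -
    interpret stage P "\<gamma> * dt P" "\<lambda>i j. \<nu>1 i j k" "\<lambda>i. G1 i k" "ls1 k" "lm1 k" "\<lambda>i. f1 i k"
      by (rule stageI[OF P \<tau> \<nu>(1) s1 k])
    define F n R c' where "F = f i k q" and "n = \<nu>1 i i k q + \<nu>1 i (other i) k q"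
      and "R = relax_op P (\<lambda>i j. \<nu>1 i j k) (ls1 k) (lm1 k) (\<lambda>i. f1 i k) i q" and "c' = c i q"
    note d = this
    have F: "F \<ge> 0" "G1 i k q = F" using f G1 k q by (auto simp: nonneg_on_def F_def)
    have c': "c' > 0" "c' * (1 + \<gamma> * dt P * n) = 1"
      using c_pos[OF q] c_sum[OF q] by (auto simp: d)
    have R: "f1 i k q = F + \<gamma> * dt P * R" using psi_minus_G_relax_op[OF q] F by (simp add: d)
    \<comment> \<open>The time step restriction times \<gamma>, with 1 - 2\<gamma> added;
      multiplying by \<open>c'\<close> then removes the bracket.\<close>
    have "(1 - 2 * \<gamma>) * (1 + \<gamma> * dt P * n) \<le> 1 - \<gamma>"
    proof -
      have "dt P * ((1 - 2 * \<gamma>) * n) \<le> 1" using dt k q by (simp add: imex_dt_bound_def \<gamma>_def n_def)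
      then have "\<gamma> * (dt P * ((1 - 2 * \<gamma>) * n)) \<le> \<gamma> * 1" using \<gamma> by (intro mult_left_mono) auto
      then show ?thesis by (simp add: algebra_simps)
    qed
    then have "c' * ((1 - 2 * \<gamma>) * (1 + \<gamma> * dt P * n)) \<le> c' * (1 - \<gamma>)"
      using c'(1) by (intro mult_left_mono) auto
    then have "(1 - 2 * \<gamma>) * (c' * (1 + \<gamma> * dt P * n)) \<le> c' * (1 - \<gamma>)"
      by (simp only: mult_ac)
    then have "1 - 2 * \<gamma> \<le> c' * (1 - \<gamma>)" unfolding c'(2) by simp
    then have "(1 - 2 * \<gamma>) * F \<le> c' * (1 - \<gamma>) * F" using F by (intro mult_right_mono)
    also have "\<dots> = (1 - \<gamma>) * (c' * F)" by simp
    also have "\<dots> \<le> (1 - \<gamma>) * (F + \<gamma> * dt P * R)"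
      using psi_ge[OF q] \<gamma> R F by (intro mult_left_mono) (auto simp: d)
    \<comment> \<open>The difference of the two ends of the chain is \<gamma> times the second-stage
      data.\<close>
    finally have "0 \<le> \<gamma> * (F + (1 - \<gamma>) * dt P * R)" by (simp add: algebra_simps)
    then have "0 \<le> F + (1 - \<gamma>) * dt P * R" using \<gamma> by (simp add: zero_le_mult_iff)
    then show ?thesis using G2 k q by (simp add: d)
  qed
  then have "nonneg_on P (cells P) G2" by (simp add: nonneg_on_def)
  then show ?thesis by (rule implicit_stages_nonneg[OF P \<tau> \<nu>(2) s2])
qed

section \<open>The relaxation step: entropy decay and equality\<close>

lemma relaxation_entropy_le:
  assumes P: "valid_params P" and k: "k \<in> cells P" and \<nu>: "nonneg_freq P \<nu>"
    and r: "relaxation_step P \<nu> f ls lm f'" and f: "nonneg_on P {k} f"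
  shows "entropy P f' k \<le> entropy P f k"
proof -
  interpret stage P "dt P" "\<lambda>i j. \<nu> i j k" "\<lambda>i. f i k" "ls k" "lm k" "\<lambda>i. f' i k"
    by (rule relaxation_stageI[OF P \<nu> r k])
  show ?thesis unfolding entropy_eq_sum
    using f by (intro entropy_le) (auto simp: nonneg_on_def)
qed

lemma relaxation_equilibrium:
  assumes P: "valid_params P" and k: "k \<in> cells P" and \<nu>: "nonneg_freq P \<nu>"
    and r: "relaxation_step P \<nu> f ls lm f'"
    and \<eta>: "\<eta> \<in> Lam_mix" and eq: "\<forall>i. \<forall>q\<in>nodes P i. f i k q = exp_mix P i \<eta> q"
  shows "entropy P f' k = entropy P f k \<and> (\<forall>i. \<forall>q\<in>nodes P i. f' i k q = exp_mix P i (lm k) q)"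
proof -
  interpret stage P "dt P" "\<lambda>i j. \<nu> i j k" "\<lambda>i. f i k" "ls k" "lm k" "\<lambda>i. f' i k"
    by (rule relaxation_stageI[OF P \<nu> r k])
  have f: "f i k q = exp_mix P i \<eta> q" if "q \<in> nodes P i" for i q
    using eq that by blast
  have *: "lm k = \<eta>" "\<And>i q. q \<in> nodes P i \<Longrightarrow> f' i k q = f i k q"
    using equilibrium[OF \<eta> f] by auto
  have "quad P i (\<lambda>q. ent (f' i k q)) = quad P i (\<lambda>q. ent (f i k q))" for i
    by (rule quad_cong) (simp add: *(2))
  then show ?thesis by (simp add: entropy_eq_sum * f)
qed

text \<open>Equality first yields the target with parameter \<open>lm k\<close>. The data are then
  exponential, so \<open>lm k\<close> also minimizes the functional that defines
  \<open>\<eta>\<close>, and uniqueness gives \<open>\<eta> = lm k\<close>. Positive cross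
  frequencies let the dissipation see every node.\<close>

lemma relaxation_entropy_eqD:
  assumes P: "valid_params P" and k: "k \<in> cells P" and \<nu>: "nonneg_freq P \<nu>"
    and r: "relaxation_step P \<nu> f ls lm f'" and f: "nonneg_on P {k} f"
    and \<eta>: "unique_minimizer (dual_mix P (\<lambda>i. \<nu> i (other i) k) (\<lambda>i. f i k)) Lam_mix \<eta>"
    and pos: "\<forall>i. \<forall>q\<in>nodes P i. \<nu> i (other i) k q > 0"
    and eq: "entropy P f' k = entropy P f k"
  shows "\<forall>i. \<forall>q\<in>nodes P i. f i k q = exp_mix P i \<eta> q"
proof -
  interpret stage P "dt P" "\<lambda>i j. \<nu> i j k" "\<lambda>i. f i k" "ls k" "lm k" "\<lambda>i. f' i k"
    by (rule relaxation_stageI[OF P \<nu> r k])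
  have *: "f i k q = exp_mix P i (lm k) q" if "q \<in> nodes P i" for i q
  proof (rule entropy_eqD[OF _ _ that])
    show "(\<Sum>i\<in>UNIV. quad P i (\<lambda>q. ent (f' i k q))) = (\<Sum>i\<in>UNIV. quad P i (\<lambda>q. ent (f i k q)))"
      using eq by (simp only: entropy_eq_sum)
    show "\<nu> i (other i) k q > 0" using pos that by blast
  qed (use f in \<open>simp add: nonneg_on_def\<close>)
  have "\<eta> = lm k"
    by (rule mix_minimizer_eq[OF P \<eta> lm_in]) (auto simp: * freq)
  then show ?thesis using * by simp
qed

theorem theorem6p1:
  fixes P :: bgk
  assumes "valid_params P"
  shows
    "(\<forall>bc ord \<nu> f ls lm f' f''.
        nonneg_freq P \<nu> \<and> cfl P (cfl_const ord) \<and>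
        relaxation_step P \<nu> f ls lm f' \<and> transport_step P bc ord f' f'' \<and>
        nonneg_on P (cells P) f \<and> nonneg_on P (ghost_cells (ncell P) bc ord) f'
        \<longrightarrow> nonneg_on P (cells P) f'')
     \<and>
     (\<forall>\<nu>1 \<nu>2 f f''.
        nonneg_freq P \<nu>1 \<and> nonneg_freq P \<nu>2 \<and> imex_dt_bound P \<nu>1 \<and>
        imex_step P (\<lambda>g i k q. 0) \<nu>1 \<nu>2 f f'' \<and> nonneg_on P (cells P) f
        \<longrightarrow> nonneg_on P (cells P) f'')
     \<and>
     (\<forall>\<nu> f ls lm f'. \<forall>k\<in>cells P.
        nonneg_freq P \<nu> \<and> relaxation_step P \<nu> f ls lm f' \<and>
        nonneg_on P {k} f \<and> (\<forall>i. \<exists>q\<in>nodes P i. f i k q \<noteq> 0)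
        \<longrightarrow> entropy P f' k \<le> entropy P f k)
     \<and>
     (\<forall>\<nu> f ls lm f' \<eta>. \<forall>k\<in>cells P.
        nonneg_freq P \<nu> \<and> relaxation_step P \<nu> f ls lm f' \<and>
        nonneg_on P {k} f \<and> (\<forall>i. \<exists>q\<in>nodes P i. f i k q \<noteq> 0) \<and>
        unique_minimizer (dual_mix P (\<lambda>i. \<nu> i (other i) k) (\<lambda>i. f i k)) Lam_mix \<eta>
        \<longrightarrow>
        ((\<forall>i. \<forall>q\<in>nodes P i. \<nu> i (other i) k q > 0) \<longrightarrow>
           (entropy P f' k = entropy P f k
            \<longleftrightarrow> (\<forall>i. \<forall>q\<in>nodes P i. f i k q = exp_mix P i \<eta> q)))
        \<and>
        ((\<forall>i. \<forall>q\<in>nodes P i. f i k q = exp_mix P i \<eta> q) \<longrightarrow>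
           entropy P f' k = entropy P f k \<and>
           (\<forall>i. \<forall>q\<in>nodes P i. f' i k q = exp_mix P i (lm k) q)))
     \<and>
     (\<forall>bc f' f''.
        (bc = Periodic \<or> bc = Zero_Flux \<and> zero_boundary_flux P First_Order f') \<and>
        cfl P 1 \<and> transport_step P bc First_Order f' f'' \<and>
        nonneg_on P (cells P) f' \<and> (\<forall>i. \<exists>k\<in>cells P. \<exists>q\<in>nodes P i. f' i k q \<noteq> 0)
        \<longrightarrow> (\<Sum>k\<in>cells P. entropy P f'' k * dx P) \<le> (\<Sum>k\<in>cells P. entropy P f' k * dx P))
     \<and>
     (\<forall>bc ord \<nu> \<nu>1 \<nu>2 (f :: nat \<Rightarrow> field).
        (bc = Periodic \<or> bc = Zero_Flux) \<and>
        (\<forall>l. nonneg_freq P (\<nu> l) \<and> nonneg_freq P (\<nu>1 l) \<and> nonneg_freq P (\<nu>2 l)) \<and>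
        ((\<forall>l. splitting_step P bc ord (\<nu> l) (f l) (f (Suc l))) \<or>
         (\<forall>l. imex_step P (transport P bc ord) (\<nu>1 l) (\<nu>2 l) (f l) (f (Suc l))))
        \<longrightarrow> (\<forall>l. total_moments P (f l) = total_moments P (f 0)))"
proof (intro conjI allI ballI impI, goal_cases)
  case (1 bc ord \<nu> f ls lm f' f'')
  then have *: "nonneg_freq P \<nu>" "implicit_stages P (dt P) \<nu> f ls lm f'" "nonneg_on P (cells P) f"
    by (simp_all add: relaxation_step_def)
  have "nonneg_on P (cells P) f'"
    by (rule implicit_stages_nonneg[OF assms dt_pos[OF assms] *])
  with 1 show ?case by (auto intro: transport_step_nonneg[OF assms])
next
  case (2 \<nu>1 \<nu>2 f f'')
  then show ?case by (auto intro: imex_step_nonneg[OF assms])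
next
  case (3 \<nu> f ls lm f' k)
  then show ?case by (auto intro: relaxation_entropy_le[OF assms])
next
  case (4 \<nu> f ls lm f' \<eta> k)
  from 4(2) have *: "nonneg_freq P \<nu>" "relaxation_step P \<nu> f ls lm f'" "nonneg_on P {k} f"
    and \<eta>: "unique_minimizer (dual_mix P (\<lambda>i. \<nu> i (other i) k) (\<lambda>i. f i k)) Lam_mix \<eta>"
    by simp_all
  then have "\<eta> \<in> Lam_mix" by (simp add: unique_minimizer_def is_arg_min_def)
  note eq = relaxation_equilibrium[OF assms 4(1) *(1,2) this, THEN conjunct1]
  note eqD = relaxation_entropy_eqD[OF assms 4(1) * \<eta> 4(3)]
  show ?case by (rule iffI, erule eqD, erule eq)
next
  case (5 \<nu> f ls lm f' \<eta> k)
  then have "nonneg_freq P \<nu>" "relaxation_step P \<nu> f ls lm f'" "\<eta> \<in> Lam_mix"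
    by (simp_all add: unique_minimizer_def is_arg_min_def)
  from relaxation_equilibrium[OF assms 5(1) this 5(3)] show ?case ..
next
  case (6 \<nu> f ls lm f' \<eta> k i q)
  then have "nonneg_freq P \<nu>" "relaxation_step P \<nu> f ls lm f'" "\<eta> \<in> Lam_mix"
    by (simp_all add: unique_minimizer_def is_arg_min_def)
  from relaxation_equilibrium[OF assms 6(1) this 6(3)] 6(4) show ?case by blast
next
  case (7 bc f' f'')
  then show ?case by (intro transport_step_total_entropy[OF assms, of bc]) auto
next
  case (8 bc ord \<nu> \<nu>1 \<nu>2 f l)
  have step: "total_moments P (f (Suc l)) = total_moments P (f l)" for l
  proof -
    from 8 have bc: "bc = Periodic \<or> bc = Zero_Flux"
      and \<nu>: "nonneg_freq P (\<nu> l)" "nonneg_freq P (\<nu>1 l)" "nonneg_freq P (\<nu>2 l)"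
      by blast+
    from 8 consider "splitting_step P bc ord (\<nu> l) (f l) (f (Suc l))"
      | "imex_step P (transport P bc ord) (\<nu>1 l) (\<nu>2 l) (f l) (f (Suc l))"
      by blast
    then show ?thesis
      using splitting_step_moments[OF assms bc \<nu>(1)] imex_step_moments[OF assms bc \<nu>(2,3)]
      by cases
  qed
  show ?case by (induction l) (simp_all add: step)
qed

end
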